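(* Let $C$ be a ternary linear $[n,k,d]$ code that is a three-weight code (its codewords have exactly three distinct nonzero Hamming weights) and that contains a codeword of weight $n$. Let $C^{\perp}$ be its dual code, with minimum weight $d^{\perp}$. Suppose $C$ satisfies the AM-condition, i.e. there exists $t\in\mathbb{N}$ with $$d^{\perp}-t=\#\{u \mid C_u\neq\emptyset,\ 0<u\leq n-t\},$$ where $C_u=\{c\in C\mid \mathrm{wt}(c)=u\}$. Then one of the following holds: (1) $d^{\perp}=6$ and $C$ is the extended ternary Golay code $[12,6,6]$, with $t=5$; or (2) $d^{\perp}\leq 5$ and $t\leq 4$.
   Context: A ternary $[n,k,d]$ code is a $k$-dimensional subspace of $\mathbb{F}_3^n$ with minimum nonzero Hamming weight $d$. $C^{\perp}$ is the dual of $C$ with respect to the standard inner product on $\mathbb{F}_3^n$. The extended ternary Golay code is the self-dual $[12,6,6]$ ternary code obtained by extending the ternary Golay code. *)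

theory Defs
  imports "HOL-Analysis.Analysis"
begin

text \<open>
  Ternary codes are sets of vectors over an arbitrary field \<open>'f\<close> with \<open>CARD('f) = 3\<close>;
  the length is the cardinality of the coordinate type \<open>'n\<close>.
\<close>

definition hamming_weight :: "'f::zero ^ 'n::finite \<Rightarrow> nat" where
  "hamming_weight c = card {i. c $ i \<noteq> 0}"

text \<open>A relation rather than a function, since the zero code has no minimum weight.\<close>

definition has_min_weight :: "('f::zero ^ 'n::finite) set \<Rightarrow> nat \<Rightarrow> bool" where
  "has_min_weight C d \<longleftrightarrow>
     (\<exists>c\<in>C - {0}. hamming_weight c = d) \<and> (\<forall>c\<in>C - {0}. d \<le> hamming_weight c)"

definition linear_code :: "('f::field ^ 'n::finite) set \<Rightarrow> nat \<Rightarrow> nat \<Rightarrow> nat \<Rightarrow> bool" where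
  "linear_code C n k d \<longleftrightarrow>
     CARD('n) = n \<and> vec.subspace C \<and> vec.dim C = k \<and> has_min_weight C d"

definition words_of_weight :: "('f::zero ^ 'n::finite) set \<Rightarrow> nat \<Rightarrow> ('f ^ 'n) set" where
  "words_of_weight C u = {c \<in> C. hamming_weight c = u}"

definition three_weight_code :: "('f::zero ^ 'n::finite) set \<Rightarrow> bool" where
  "three_weight_code C \<longleftrightarrow> card (hamming_weight ` (C - {0})) = 3"

definition dual_code :: "('f::field ^ 'n::finite) set \<Rightarrow> ('f ^ 'n) set" where
  "dual_code C = {v. \<forall>c\<in>C. (\<Sum>i\<in>UNIV. v $ i * c $ i) = 0}"

text \<open>Both differences are taken in the integers, so neither is truncated at 0.\<close>

definition AM_condition :: "('f::zero ^ 'n::finite) set \<Rightarrow> nat \<Rightarrow> nat \<Rightarrow> nat \<Rightarrow> bool" where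
  "AM_condition C n d' t \<longleftrightarrow>
     int d' - int t =
       int (card {u. words_of_weight C u \<noteq> {} \<and> 0 < u \<and> int u \<le> int n - int t})"

definition monomially_equivalent ::
    "('f::field ^ 'n::finite) set \<Rightarrow> ('f ^ 'm::finite) set \<Rightarrow> bool" where
  "monomially_equivalent C D \<longleftrightarrow>
     (\<exists>(\<sigma> :: 'm \<Rightarrow> 'n) (a :: 'm \<Rightarrow> 'f).
        bij \<sigma> \<and> (\<forall>j. a j \<noteq> 0) \<and> D = (\<lambda>c. \<chi> j. a j * c $ \<sigma> j) ` C)"

text \<open>
  The ternary Golay code is the cyclic code of length 11 with generator polynomial
  \<open>x^5 + x^4 - x^3 + x^2 - 1\<close>, a factor of \<open>x^11 - 1\<close> over the field with three elements.
  Arithmetic on the coordinate type \<open>11\<close> is modulo 11.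
\<close>

definition golay_generator :: "'f::field ^ 11" where
  "golay_generator =
     (\<chi> i. if i \<in> {2, 4, 5} then 1 else if i \<in> {0, 3} then - 1 else 0)"

definition ternary_golay_code :: "('f::field ^ 11) set" where
  "ternary_golay_code = vec.span (range (\<lambda>s. \<chi> i. golay_generator $ (i - s)))"

text \<open>The new coordinate \<open>None\<close> is the overall parity check.\<close>

definition extend_word :: "'f::field ^ 'n::finite \<Rightarrow> 'f ^ 'n option" where
  "extend_word c = (\<chi> i. case i of None \<Rightarrow> - (\<Sum>j\<in>UNIV. c $ j) | Some j \<Rightarrow> c $ j)"

definition extended_ternary_golay_code :: "('f::field ^ 11 option) set" where
  "extended_ternary_golay_code = extend_word ` ternary_golay_code"

end

theory Submission
  imports Defs
begin

text \<open>
  A code of dual distance at least 6 takes all values on any five coordinates, which fixes the first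
  five binomial moments of its weights. With weights \<open>w1\<close>, \<open>w2\<close> and \<open>n\<close>, the words vanishing at
  one coordinate form a two-weight code of length \<open>m = n - 1\<close>, and these moments force
  \<open>3 ^ (k - 1) = 2 * m\<^sup>2 + 1\<close>, \<open>9 * w1 * w2 = 2 * 3 ^ (k - 1)\<close> and \<open>3 * (w1 + w2) = 4 * m + 1\<close>
  (its dual is a perfect code, and \<open>w1\<close>, \<open>w2\<close> are the zeros of the Lloyd polynomial). The only
  solution is \<open>n = 12\<close>, \<open>k = 6\<close> with weights 6, 9, 12. All weights being divisible by 3, the code
  is self-orthogonal, so \<open>d' = 6\<close>. In systematic form \<open>[I | A]\<close> the rows of \<open>A\<close> have weight 5 and
  are pairwise orthogonal, so \<open>A\<close> is a conference matrix of order 6; up to monomial equivalence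
  there is only one, the bordered pentagon matrix, and the extended Golay code has this form as well.
  The remaining case \<open>d' = t = 5\<close> would be a four-dimensional code whose nonzero words vanish
  on at most three coordinates; these have length 5 and four weights.
\<close>

section \<open>Values and moments of a code with given dual distance\<close>

lemma ternary_cases:
  fixes x :: "'f::field"
  assumes "CARD('f) = 3"
  shows "x = 0 \<or> x = 1 \<or> x = - 1" and "(2::'f) = - 1" and "(1::'f) \<noteq> - 1"
proof -
  have fin: "finite (UNIV :: 'f set)"
    using assms by (simp add: card_ge_0_finite)
  show ne: "(1::'f) \<noteq> - 1"
  proof
    assume "(1::'f) = - 1"
    have "{0, 1 :: 'f} \<noteq> UNIV"
    proof
      assume "{0, 1 :: 'f} = UNIV"
      then have "card {0, 1 :: 'f} = 3"
        using assms by simp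
      then show False
        by simp
    qed
    \<comment> \<open>In characteristic 2 a third element \<open>a\<close> brings a fourth,
      \<open>a + 1\<close>.\<close>
    then obtain a :: 'f where a: "a \<noteq> 0" "a \<noteq> 1"
      by blast
    have "a + 1 \<noteq> 0"
      unfolding add_eq_0_iff2 \<open>1 = - 1\<close>[symmetric] using a(2) .
    with a have "card {0, 1, a, a + 1} = 4"
      by auto
    then show False
      using card_mono[OF fin, of "{0, 1, a, a + 1}"] assms by simp
  qed
  have "card {0, 1, - 1 :: 'f} = 3"
    using ne by simp
  then have univ: "{0, 1, - 1 :: 'f} = UNIV"
    using card_subset_eq[OF fin, of "{0, 1, - 1}"] assms by simp
  then show "x = 0 \<or> x = 1 \<or> x = - 1"
    by blast
  have "(1 + 1 :: 'f) \<in> {0, 1, - 1}"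
    using univ by blast
  moreover have "(1 + 1 :: 'f) \<noteq> 0"
    using ne unfolding add_eq_0_iff2 .
  moreover have "(1 + 1 :: 'f) \<noteq> 1"
    using add_left_cancel[of "1::'f" 1 0] by simp
  ultimately have "(1 + 1 :: 'f) = - 1"
    by blast
  then show "(2::'f) = - 1"
    by (simp only: one_add_one)
qed

lemma finite_UNIV_vec:
  assumes "finite (UNIV :: 'f set)"
  shows "finite (UNIV :: ('f ^ 'n::finite) set)"
proof -
  have "finite (UNIV :: ('n \<Rightarrow> 'f) set)"
    using assms by (simp add: finite_UNIV_fun)
  then have "finite (range (vec_lambda :: ('n \<Rightarrow> 'f) \<Rightarrow> _))"
    by blast
  moreover have "range (vec_lambda :: ('n \<Rightarrow> 'f) \<Rightarrow> _) = UNIV"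
    by (auto intro: image_eqI[of x _ "vec_nth x" for x])
  ultimately show ?thesis
    by simp
qed

lemma ternary_finite_words:
  fixes C :: "('f::field ^ 'n::finite) set"
  assumes "CARD('f) = 3"
  shows "finite C"
  by (rule finite_subset[OF subset_UNIV finite_UNIV_vec])
    (use assms in \<open>simp add: card_ge_0_finite\<close>)

text \<open>A basis of \<open>W\<close> stays independent when \<open>x\<close> is added, so some
  linear functional vanishes on \<open>W\<close> and takes the value 1 at \<open>x\<close>; its
  coefficient vector is the dual word. The functional has values in \<open>'f ^ 1\<close>, which
  makes it a one-row matrix.\<close>

lemma dual_code_separates:
  fixes W :: "('f::field ^ 'n::finite) set"
  assumes "vec.subspace W" and "x \<notin> W"
  shows "\<exists>v\<in>dual_code W. (\<Sum>i\<in>UNIV. v $ i * x $ i) \<noteq> 0"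
proof -
  obtain B where B: "B \<subseteq> W" "vec.independent B" "W \<subseteq> vec.span B"
    by (rule vec.basis_exists[of W])
  have span: "vec.span B = W"
    using B assms(1) by (simp add: vec.span_subspace)
  then have "vec.independent (insert x B)"
    using B assms(2) by (simp add: vec.independent_insertI)
  from vec.linear_independent_extend[OF this, of "\<lambda>b. if b = x then 1 else 0 :: 'f ^ 1"]
  obtain f :: "'f ^ 'n \<Rightarrow> 'f ^ 1"
    where f: "Vector_Spaces.linear (*s) (*s) f"
      and fB: "\<forall>b\<in>insert x B. f b = (if b = x then 1 else 0)"
    by blast
  define v where "v = matrix f $ 1"
  have fv: "f y $ 1 = (\<Sum>i\<in>UNIV. v $ i * y $ i)" for y
    unfolding matrix_works[OF f, of y, symmetric] v_def by (simp add: matrix_vector_mult_def)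
  have "f w = 0" if "w \<in> W" for w
  proof -
    have "f b = 0" if "b \<in> B" for b
      using fB that assms(2) B(1) by auto
    then show ?thesis
      using vec.linear_eq_0_on_span[OF f] span that by blast
  qed
  then have "v \<in> dual_code W"
    by (simp add: dual_code_def flip: fv)
  moreover have "f x $ 1 = 1"
    using fB by simp
  ultimately show ?thesis
    by (intro bexI[of _ v]) (simp_all flip: fv)
qed

text \<open>The words that agree on \<open>J\<close> with some codeword form a space
  \<open>W\<close> that contains \<open>C\<close> and every unit vector outside \<open>J\<close>. A
  word dual to \<open>W\<close> is therefore dual to \<open>C\<close> and supported on
  \<open>J\<close>, too light to be nonzero, so nothing can separate \<open>x\<close> from
  \<open>W\<close>.\<close>

lemma code_attains_values:
  fixes C :: "('f::field ^ 'n::finite) set"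
  assumes C: "vec.subspace C" and d': "has_min_weight (dual_code C) d'" and J: "card J < d'"
  shows "\<exists>c\<in>C. \<forall>j\<in>J. c $ j = x j"
proof -
  define W where "W = {w. \<exists>c\<in>C. \<forall>j\<in>J. w $ j = c $ j}"
  have "vec.subspace W"
    unfolding vec.subspace_def
  proof (intro conjI ballI allI)
    show "0 \<in> W"
      using vec.subspace_0[OF C] by (force simp: W_def)
  next
    fix u w assume "u \<in> W" "w \<in> W"
    then obtain a b where "a \<in> C" "b \<in> C" "\<forall>j\<in>J. u $ j = a $ j" "\<forall>j\<in>J. w $ j = b $ j"
      by (auto simp: W_def)
    then show "u + w \<in> W"
      using vec.subspace_add[OF C] by (auto simp: W_def intro!: bexI[of _ "a + b"])
  next
    fix r w assume "w \<in> W"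
    then obtain b where "b \<in> C" "\<forall>j\<in>J. w $ j = b $ j"
      by (auto simp: W_def)
    then show "r *s w \<in> W"
      using vec.subspace_scale[OF C] by (auto simp: W_def intro!: bexI[of _ "r *s b"])
  qed
  have "(\<chi> j. x j) \<in> W"
  proof (rule ccontr)
    assume "(\<chi> j. x j) \<notin> W"
    then obtain v where v: "v \<in> dual_code W" "(\<Sum>i\<in>UNIV. v $ i * (\<chi> j. x j) $ i) \<noteq> 0"
      using dual_code_separates[OF \<open>vec.subspace W\<close>] by blast
    have "C \<subseteq> W"
      by (auto simp: W_def)
    then have "v \<in> dual_code C"
      using v(1) by (auto simp: dual_code_def)
    moreover have "v \<noteq> 0"
      using v(2) by auto
    ultimately have "d' \<le> hamming_weight v"
      using d' by (auto simp: has_min_weight_def)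
    moreover have "v $ j = 0" if "j \<notin> J" for j
    proof -
      have "axis j 1 \<in> W"
        using that vec.subspace_0[OF C] by (auto simp: W_def axis_def intro!: bexI[of _ 0])
      then have "(\<Sum>i\<in>UNIV. v $ i * axis j 1 $ i) = 0"
        using v(1) by (simp add: dual_code_def)
      then show ?thesis
        by (simp add: axis_def if_distrib cong: if_cong)
    qed
    then have "hamming_weight v \<le> card J"
      unfolding hamming_weight_def by (intro card_mono) auto
    ultimately show False
      using J by simp
  qed
  then show ?thesis
    by (force simp: W_def)
qed

lemma card_span_insert:
  fixes B :: "('f::field ^ 'n::finite) set"
  assumes "b \<notin> vec.span B"
  shows "card (vec.span (insert b B)) = CARD('f) * card (vec.span B)"
proof -
  have "bij_betw (\<lambda>(a, w). w + a *s b) (UNIV \<times> vec.span B) (vec.span (insert b B))"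
    unfolding bij_betw_def
  proof
    show "inj_on (\<lambda>(a, w). w + a *s b) (UNIV \<times> vec.span B)"
    proof (rule inj_onI, clarify)
      fix a a' :: 'f and w w'
      assume w: "w \<in> vec.span B" "w' \<in> vec.span B" and eq: "w + a *s b = w' + a' *s b"
      have "(a - a') *s b = w' - w"
        using eq by (simp add: vec.scale_left_diff_distrib algebra_simps)
      then have "(a - a') *s b \<in> vec.span B"
        using w by (simp add: vec.span_diff)
      then have "a = a'"
        using assms vec.span_scale[of "(a - a') *s b" B "inverse (a - a')"]
        by (cases "a = a'")
          (auto simp only: vec.scale_scale left_inverse vec.scale_one right_minus_eq simp_thms)
      then show "a = a' \<and> w = w'"
        using eq by simp
    qed
    show "(\<lambda>(a, w). w + a *s b) ` (UNIV \<times> vec.span B) = vec.span (insert b B)"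
      (is "?L = ?R")
    proof
      show "?L \<subseteq> ?R"
        by (auto intro!: vec.span_add vec.span_scale intro: vec.span_base
            subsetD[OF vec.span_mono[OF subset_insertI]])
      show "?R \<subseteq> ?L"
      proof
        fix x assume "x \<in> ?R"
        then obtain a where "x - a *s b \<in> vec.span B"
          by (auto simp: vec.span_insert)
        then show "x \<in> ?L"
          by (intro image_eqI[of _ _ "(a, x - a *s b)"]) auto
      qed
    qed
  qed
  from bij_betw_same_card[OF this] show ?thesis
    by (simp add: card_cartesian_product)
qed

lemma card_subspace:
  fixes C :: "('f::field ^ 'n::finite) set"
  assumes "vec.subspace C"
  shows "card C = CARD('f) ^ vec.dim C"
proof -
  obtain B where B: "B \<subseteq> C" "vec.independent B" "C \<subseteq> vec.span B" "card B = vec.dim C"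
    using vec.basis_exists by blast
  have "finite B"
    using B(2) vec.finiteI_independent by blast
  then have "vec.independent B \<Longrightarrow> card (vec.span B) = CARD('f) ^ card B"
  proof (induction B rule: finite_induct)
    case empty
    then show ?case by simp
  next
    case (insert b B)
    then show ?case
      by (simp add: card_span_insert vec.independent_insert)
  qed
  moreover have "vec.span B = C"
    using B assms by (simp add: vec.span_subspace)
  ultimately show ?thesis
    using B by simp
qed

text \<open>Below the dual distance each new condition divides the count by the field size: a
  codeword that is 1 at the new coordinate \<open>i\<close> and 0 on \<open>J\<close> splits the
  words vanishing on \<open>J\<close> into translates of those that vanish at \<open>i\<close> as
  well.\<close>

lemma card_vanishing_words:
  fixes C :: "('f::field ^ 'n::finite) set"
  assumes C: "vec.subspace C" and d': "has_min_weight (dual_code C) d'"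
  shows "card J < d' \<Longrightarrow> CARD('f) ^ card J * card {c\<in>C. \<forall>j\<in>J. c $ j = 0} = card C"
proof (induction J rule: finite_induct[OF finite])
  case 1
  then show ?case by simp
next
  case (2 i J)
  have "card (insert i J) < d'"
    using 2 by simp
  from code_attains_values[OF C d' this, of "\<lambda>j. if j = i then 1 else 0"]
  obtain b where "b \<in> C" "\<forall>j\<in>insert i J. b $ j = (if j = i then 1 else 0)"
    by blast
  with 2 have b: "b \<in> C" "b $ i = 1" "\<forall>j\<in>J. b $ j = 0"
    by auto
  have "bij_betw (\<lambda>(a, w). w + a *s b) (UNIV \<times> {c\<in>C. \<forall>j\<in>insert i J. c $ j = 0})
          {c\<in>C. \<forall>j\<in>J. c $ j = 0}"
    (is "bij_betw _ ?X ?Y")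
  proof (rule bij_betwI[where g = "\<lambda>c. (c $ i, c - (c $ i) *s b)"])
    show "(\<lambda>(a, w). w + a *s b) \<in> ?X \<rightarrow> ?Y"
      using b vec.subspace_add[OF C] vec.subspace_scale[OF C] by auto
    show "(\<lambda>c. (c $ i, c - (c $ i) *s b)) \<in> ?Y \<rightarrow> ?X"
      using b vec.subspace_diff[OF C] vec.subspace_scale[OF C] by auto
  qed (use b in auto)
  from bij_betw_same_card[OF this]
  have "CARD('f) * card {c\<in>C. \<forall>j\<in>insert i J. c $ j = 0} = card {c\<in>C. \<forall>j\<in>J. c $ j = 0}"
    by (simp only: card_cartesian_product)
  moreover have "CARD('f) ^ card (insert i J) = CARD('f) ^ card J * CARD('f)"
    using 2 by simp
  ultimately show ?case
    using 2 by (simp only: mult.assoc card_insert_disjoint) simp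
qed

text \<open>Double counting of the pairs of a codeword and a \<open>j\<close>-set of its zero
  coordinates.\<close>

lemma sum_choose_zeros:
  fixes C :: "('f::field ^ 'n::finite) set"
  assumes q: "CARD('f) = 3" and C: "vec.subspace C" and d': "has_min_weight (dual_code C) d'"
    and "j < d'"
  shows "3 ^ j * (\<Sum>c\<in>C. (CARD('n) - hamming_weight c) choose j) = (CARD('n) choose j) * card C"
proof -
  have zeros: "CARD('n) - hamming_weight c = card {i. c $ i = 0}" for c :: "'f ^ 'n"
  proof -
    have "{i. c $ i = 0} = UNIV - {i. c $ i \<noteq> 0}"
      by auto
    then show ?thesis
      by (simp add: hamming_weight_def card_Diff_subset)
  qed
  have "(\<Sum>c\<in>C. (CARD('n) - hamming_weight c) choose j) =
        (\<Sum>c\<in>C. card {J. J \<subseteq> {i. c $ i = 0} \<and> card J = j})"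
    by (simp add: zeros n_subsets)
  also have "\<dots> = (\<Sum>c\<in>C. card {J \<in> {J. card J = j}. \<forall>i\<in>J. c $ i = 0})"
    by (intro sum.cong refl arg_cong[where f = card]) auto
  also have "\<dots> = (\<Sum>J\<in>{J. card J = j}. card {c\<in>C. \<forall>i\<in>J. c $ i = 0})"
    using sum.swap_restrict[of C "{J :: 'n set. card J = j}" "\<lambda>_ _. 1::nat" "\<lambda>c J. \<forall>i\<in>J. c $ i = 0"]
      ternary_finite_words[OF q, of C] by simp
  finally have "3 ^ j * (\<Sum>c\<in>C. (CARD('n) - hamming_weight c) choose j) =
      (\<Sum>J\<in>{J :: 'n set. card J = j}. 3 ^ j * card {c\<in>C. \<forall>i\<in>J. c $ i = 0})"
    by (simp add: sum_distrib_left)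
  also have "\<dots> = (\<Sum>J\<in>{J :: 'n set. card J = j}. card C)"
    using card_vanishing_words[OF C d'] \<open>j < d'\<close> q by (intro sum.cong) auto
  also have "\<dots> = (CARD('n) choose j) * card C"
    using n_subsets[of "UNIV :: 'n set" j] by simp
  finally show ?thesis .
qed

section \<open>Two weights on a design of strength four\<close>

text \<open>\<open>b1\<close> and \<open>b2\<close> stand for the numbers of words with
  \<open>z1\<close> and \<open>z2\<close> zeros among the \<open>Q\<close> words of a code of length
  \<open>m\<close>; each term - 1 on the right removes the zero word, which has \<open>m\<close>
  zeros. The counts are real because they will arise by division.\<close>

lemma two_weight_moments:
  fixes b1 b2 z1 z2 m Q :: real
  assumes M0: "b1 + b2 = Q - 1"
    and M1: "b1 * z1 + b2 * z2 = m * (Q / 3 - 1)"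
    and M2: "b1 * (z1 * (z1 - 1)) + b2 * (z2 * (z2 - 1)) = m * (m - 1) * (Q / 9 - 1)"
    and M3: "b1 * (z1 * (z1 - 1) * (z1 - 2)) + b2 * (z2 * (z2 - 1) * (z2 - 2)) =
      m * (m - 1) * (m - 2) * (Q / 27 - 1)"
    and M4: "b1 * (z1 * (z1 - 1) * (z1 - 2) * (z1 - 3)) + b2 * (z2 * (z2 - 1) * (z2 - 2) * (z2 - 3)) =
      m * (m - 1) * (m - 2) * (m - 3) * (Q / 81 - 1)"
    and m: "m > 1" and Q: "Q > 0"
  shows "Q = 2 * m\<^sup>2 + 1" and "9 * ((m - z1) * (m - z2)) = 2 * Q"
    and "3 * ((m - z1) + (m - z2)) = 4 * m + 1"
proof -
  define \<alpha> where "\<alpha> = 1 - z1 - z2"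
  define \<beta> where "\<beta> = z1 * z2"
  define P where "P = m * (m - 1) + \<alpha> * m + \<beta>"
  have P: "(m - z1) * (m - z2) = P"
    by (simp add: P_def \<alpha>_def \<beta>_def algebra_simps)
  define E0 where "E0 = Q * (m * (m - 1) / 9 + \<alpha> * m / 3 + \<beta>) - P"
  define E1 where "E1 = Q * (m * (m - 1) * (m - 2) / 27 + 2 * m * (m - 1) / 9 +
      \<alpha> * (m * (m - 1) / 9 + m / 3) + \<beta> * m / 3) - m * P"
  define E2 where "E2 = Q * (m * (m - 1) * (m - 2) * (m - 3) / 81 + 4 * m * (m - 1) * (m - 2) / 27
      + 2 * m * (m - 1) / 9 + \<alpha> * (m * (m - 1) * (m - 2) / 27 + 2 * m * (m - 1) / 9)
      + \<beta> * m * (m - 1) / 9) - m * (m - 1) * P"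
  \<comment> \<open>The polynomial \<open>(z - z1) * (z - z2) = z * (z - 1) + \<alpha> * z + \<beta>\<close> times
    \<open>1\<close>, \<open>z\<close> and \<open>z * (z - 1)\<close>, summed over the words.\<close>
  have "E0 = m * (m - 1) * (Q / 9 - 1) + \<alpha> * (m * (Q / 3 - 1)) + \<beta> * (Q - 1)"
    by (simp add: E0_def P_def algebra_simps add_divide_distrib diff_divide_distrib)
  also have "\<dots> = 0"
    unfolding M0[symmetric] M1[symmetric] M2[symmetric] \<alpha>_def \<beta>_def by (simp add: algebra_simps)
  finally have E0: "E0 = 0" .
  have "E1 = m * (m - 1) * (m - 2) * (Q / 27 - 1) + (2 + \<alpha>) * (m * (m - 1) * (Q / 9 - 1))
      + (\<alpha> + \<beta>) * (m * (Q / 3 - 1))"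
    by (simp add: E1_def P_def algebra_simps add_divide_distrib diff_divide_distrib)
  also have "\<dots> = 0"
    unfolding M1[symmetric] M2[symmetric] M3[symmetric] \<alpha>_def \<beta>_def by (simp add: algebra_simps)
  finally have E1: "E1 = 0" .
  have "E2 = m * (m - 1) * (m - 2) * (m - 3) * (Q / 81 - 1)
      + (4 + \<alpha>) * (m * (m - 1) * (m - 2) * (Q / 27 - 1))
      + (2 + 2 * \<alpha> + \<beta>) * (m * (m - 1) * (Q / 9 - 1))"
    by (simp add: E2_def P_def algebra_simps add_divide_distrib diff_divide_distrib)
  also have "\<dots> = 0"
    unfolding M4[symmetric] M2[symmetric] M3[symmetric] \<alpha>_def \<beta>_def by (simp add: algebra_simps)
  finally have E2: "E2 = 0" .
  \<comment> \<open>Combining the three sums into the Krawtchouk polynomials of degree 1 and 2 decouples them.\<close>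
  have "E1 - m / 3 * E0 = 2 * m / 3 * (Q * (2 * (m - 1) / 9 + \<alpha> / 3) - P)"
    by (simp add: E0_def E1_def algebra_simps add_divide_distrib diff_divide_distrib)
  then have F1: "Q * (2 * (m - 1) / 9 + \<alpha> / 3) = P"
    using E0 E1 m by simp
  \<comment> \<open>The multipliers are the coefficients of the quadratic Krawtchouk polynomial
    \<open>9 / 2 * z * (z - 1) + (3 - 3 * m) * z + m * (m - 1) / 2\<close> in the number
    \<open>z\<close> of zeros.\<close>
  have "9 / 2 * E2 + (3 - 3 * m) * E1 + m * (m - 1) / 2 * E0 = m * (m - 1) * (4 * Q / 9 - 2 * P)"
    by (simp add: E0_def E1_def E2_def algebra_simps add_divide_distrib diff_divide_distrib)
  then have "m * (m - 1) * (4 * Q / 9 - 2 * P) = 0"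
    using E0 E1 E2 by simp
  then have F2: "9 * P = 2 * Q"
    using m by simp
  show "9 * ((m - z1) * (m - z2)) = 2 * Q"
    using F2 P by simp
  have "Q * (2 * (m - 1) / 9 + \<alpha> / 3) = Q * (2 / 9)"
    using F1 F2 by simp
  then have "2 * (m - 1) / 9 + \<alpha> / 3 = 2 / 9"
    using Q by (metis mult_cancel_left less_irrefl)
  then have \<alpha>: "\<alpha> = (4 - 2 * m) / 3"
    by (simp add: field_simps)
  then show "3 * ((m - z1) + (m - z2)) = 4 * m + 1"
    by (simp add: \<alpha>_def field_simps)
  have "Q * (m * (m - 1) / 9 + \<alpha> * m / 3 + \<beta>) = Q * (2 / 9)"
    using E0 F2 by (simp add: E0_def)
  then have "m * (m - 1) / 9 + \<alpha> * m / 3 + \<beta> = 2 / 9"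
    using Q by (metis mult_cancel_left less_irrefl)
  then have "\<beta> = 2 / 9 - m * (m - 1) / 9 - \<alpha> * m / 3"
    by simp
  then have "9 * P = 4 * m\<^sup>2 + 2"
    unfolding P_def \<alpha> by (simp add: field_simps power2_eq_square)
  then show "Q = 2 * m\<^sup>2 + 1"
    using F2 by simp
qed

section \<open>Diophantine equations for the two weights\<close>

text \<open>Eliminating \<open>m\<close> leaves
  \<open>3 * (A - 2 * B)\<^sup>2 = 2 * A + 4 * B - 3\<close> for the powers \<open>A\<close> and
  \<open>B\<close> of 3. If 9 divided both, it would divide 3; otherwise one exponent is 0 or 1 and
  a quadratic equation for the other power remains.\<close>

lemma ternary_lloyd_aux:
  fixes a b m :: nat
  assumes sum: "3 * (3 ^ a + 2 * 3 ^ b) = 4 * m + 1" and prod: "9 * (3 ^ a * 3 ^ b) = 2 * m\<^sup>2 + 1"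
    and m: "m \<ge> 3"
  shows "a = 2 \<and> b = 1 \<and> m = 11"
proof -
  define A B :: int where "A = 3 ^ a" and "B = 3 ^ b"
  have "int (3 * (3 ^ a + 2 * 3 ^ b)) = int (4 * m + 1)" "int (9 * (3 ^ a * 3 ^ b)) = int (2 * m\<^sup>2 + 1)"
    using sum prod by presburger+
  then have sum': "4 * int m = 3 * (A + 2 * B) - 1" and prod': "9 * (A * B) = 2 * (int m)\<^sup>2 + 1"
    by (simp_all add: A_def B_def)
  have "8 * (9 * (A * B)) = (4 * int m)\<^sup>2 + 8"
    unfolding prod' by (simp add: power2_eq_square)
  then have "3 * (3 * (A - 2 * B)\<^sup>2) = 3 * (2 * A + 4 * B - 3)"
    unfolding sum' by (simp add: power2_eq_square algebra_simps)
  then have eq: "3 * (A - 2 * B)\<^sup>2 = 2 * A + 4 * B - 3"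
    by (simp only: mult_left_cancel)
  \<comment> \<open>Equality would belong to the solution \<open>A = B = 1\<close> with
    \<open>m = 2\<close>.\<close>
  have sum3: "A + 2 * B \<noteq> 3"
    using sum' m by auto
  consider "b = 0" | "b = 1" | "b \<ge> 2" "a = 0" | "b \<ge> 2" "a = 1" | "b \<ge> 2" "a \<ge> 2"
    by linarith
  then show ?thesis
  proof cases
    case 1
    then have "(A - 1) * (3 * A - 11) = 0"
      using eq by (simp add: B_def power2_eq_square algebra_simps)
    moreover have "3 * A \<noteq> 11"
      by presburger
    moreover have "A \<noteq> 1"
      using sum3 1 by (simp add: B_def)
    ultimately show ?thesis
      by simp
  next
    case 2
    then have "(A - 9) * (3 * A - 11) = 0"
      using eq by (simp add: B_def power2_eq_square algebra_simps)
    moreover have "3 * A \<noteq> 11"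
      by presburger
    ultimately have "A = 9"
      by simp
    then have "(3::int) ^ a = 3 ^ 2"
      by (simp add: A_def)
    then have "a = 2"
      by (subst (asm) power_inject_exp) auto
    then show ?thesis
      using 2 sum by simp
  next
    case 3
    then have "(B - 1) * (3 * B - 1) = 0"
      using eq by (simp add: A_def power2_eq_square algebra_simps)
    moreover have "3 * B \<noteq> 1"
      by presburger
    moreover have "B \<noteq> 1"
      using sum3 3 by (simp add: A_def)
    ultimately show ?thesis
      by simp
  next
    case 4
    have "B \<ge> 3 ^ 2"
      unfolding B_def using 4 by (intro power_increasing) auto
    then have "B * (3 * B - 10) > 0"
      by (intro mult_pos_pos) auto
    moreover have "B * (3 * B - 10) = - 6"
      using eq 4 by (simp add: A_def power2_eq_square algebra_simps)
    ultimately show ?thesis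
      by simp
  next
    case 5
    have dvd: "9 dvd A" "9 dvd B"
      using le_imp_power_dvd[of 2 a "3::int"] le_imp_power_dvd[of 2 b "3::int"] 5
      by (simp_all add: A_def B_def)
    then obtain x y where xy: "A = 9 * x" "B = 9 * y"
      by (auto simp: dvd_def)
    have "3 = 9 * (2 * x + 4 * y - 27 * (x - 2 * y)\<^sup>2)"
      using eq by (simp add: xy power2_eq_square algebra_simps)
    then have "9 dvd (3::int)"
      by (rule dvdI)
    then show ?thesis
      by simp
  qed
qed

text \<open>The product makes one weight a power of 3 and the other twice a power of 3.\<close>

lemma ternary_lloyd_equation:
  fixes w1 w2 m r :: nat
  assumes sum: "3 * (w1 + w2) = 4 * m + 1" and prod: "9 * (w1 * w2) = 2 * 3 ^ r"
    and r: "3 ^ r = 2 * m\<^sup>2 + 1" and m: "m \<ge> 3"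
  shows "{w1, w2} = {6, 9}" and "m = 11" and "r = 5"
proof -
  have *: "w = 9 \<and> 2 * v = 6 \<and> m = 11"
    if "3 * (w + 2 * v) = 4 * m + 1" "9 * (w * (2 * v)) = 2 * 3 ^ r" for w v
  proof -
    have wv: "9 * (w * v) = 3 ^ r"
      using that(2) by (simp add: mult.commute)
    have "w dvd 3 ^ r" "v dvd 3 ^ r"
      unfolding wv[symmetric] by simp_all
    then obtain a b where "w = 3 ^ a" "v = 3 ^ b"
      using divides_primepow_nat[of 3] by auto
    then show ?thesis
      using ternary_lloyd_aux[of a b m] that(1) wv r m by simp
  qed
  have "even (9 * (w1 * w2))"
    using prod by simp
  then consider v where "w2 = 2 * v" | v where "w1 = 2 * v"
    by auto
  then have "{w1, w2} = {6, 9} \<and> m = 11"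
  proof cases
    case 1
    then show ?thesis
      using *[of w1 v] sum prod by auto
  next
    case 2
    then show ?thesis
      using *[of w2 v] sum prod by (auto simp: add.commute mult.commute)
  qed
  then show "{w1, w2} = {6, 9}" and m11: "m = 11"
    by auto
  have "(3::nat) ^ r = 3 ^ 5"
    using r m11 by simp
  then show "r = 5"
    by (subst (asm) power_inject_exp) auto
qed

section \<open>Weights of a code with dual distance at least 6\<close>

lemma hamming_weight_le: "hamming_weight (c :: 'f::zero ^ 'n::finite) \<le> CARD('n)"
  unfolding hamming_weight_def by (intro card_mono) auto

lemma hamming_weight_eq_0_iff: "hamming_weight (c :: 'f::zero ^ 'n::finite) = 0 \<longleftrightarrow> c = 0"
  by (auto simp: hamming_weight_def vec_eq_iff)

lemma real_choose_eq: "fact j * real (x choose j) = (\<Prod>i = 0..<j. real x - real i)"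
  by (simp add: binomial_gbinomial gbinomial_prod_rev)

text \<open>Words of weight \<open>n\<close> have no zeros and drop out of the moments of order 1 to
  5. Divided by \<open>n\<close>, these become the moments of order 0 to 4 in length
  \<open>n - 1\<close> to which \<open>two_weight_moments\<close> applies.\<close>

lemma three_weight_dual_distance_6:
  fixes C :: "('f::field ^ 'n::finite) set"
  assumes q: "CARD('f) = 3" and C: "vec.subspace C" and three: "three_weight_code C"
    and full: "\<exists>c\<in>C. hamming_weight c = CARD('n)"
    and d': "has_min_weight (dual_code C) d'" "6 \<le> d'"
  shows "CARD('n) = 12" and "vec.dim C = 6" and "hamming_weight ` (C - {0}) = {6, 9, 12}"
proof -
  define n where "n = CARD('n)"
  define W where "W = hamming_weight ` (C - {0})"
  have finC: "finite C"
    by (rule ternary_finite_words[OF q])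
  obtain v where "v \<in> dual_code C" "hamming_weight v = d'"
    using d'(1) by (auto simp: has_min_weight_def)
  then have n6: "n \<ge> 6"
    using hamming_weight_le[of v] d'(2) by (simp add: n_def)
  then have nW: "n \<in> W"
    using full by (force simp: W_def n_def[symmetric] hamming_weight_eq_0_iff[symmetric])
  have cardW: "card W = 3"
    using three by (simp add: three_weight_code_def W_def)
  then have "card (W - {n}) = 2"
    using nW by simp
  then obtain w1 w2 where w12: "W - {n} = {w1, w2}" "w1 \<noteq> w2"
    by (auto simp: card_2_iff)
  then have W: "W = {w1, w2, n}" and ne: "w1 \<noteq> n" "w2 \<noteq> n"
    using nW by auto
  have le: "w \<le> n \<and> w \<noteq> 0" if w: "w \<in> W" for w
  proof -
    obtain c where "c \<in> C - {0}" "w = hamming_weight c"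
      using w by (auto simp: W_def)
    then show ?thesis
      using hamming_weight_le[of c] hamming_weight_eq_0_iff[of c] by (simp add: n_def)
  qed
  have w1: "w1 < n" "0 < w1" and w2: "w2 < n" "0 < w2"
    using le[of w1] le[of w2] ne W by simp_all
  define a where "a w = card {c \<in> C - {0}. hamming_weight c = w}" for w
  define x1 x2 where "x1 = n - w1" and "x2 = n - w2"
  have x: "real x1 = real n - real w1" "real x2 = real n - real w2" "x1 > 0" "x2 > 0"
    using w1 w2 by (simp_all add: x1_def x2_def)
  define T where "T = real (card C)"
  have T: "T = 3 ^ vec.dim C"
    using card_subspace[OF C] q by (simp add: T_def)
  have moments: "real (a w1) * (\<Prod>i = 0..<j. real x1 - real i) + real (a w2) * (\<Prod>i = 0..<j. real x2 - real i)
      = (\<Prod>i = 0..<j. real n - real i) * (T / 3 ^ j - 1)"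
    if j: "1 \<le> j" "j \<le> 5" for j
  proof -
    have "(\<Sum>c\<in>C. (n - hamming_weight c) choose j) =
        (n choose j) + (\<Sum>c\<in>C - {0}. (n - hamming_weight c) choose j)"
      using vec.subspace_0[OF C] finC by (subst sum.remove[of C 0]) (auto simp: hamming_weight_def)
    also have "(\<Sum>c\<in>C - {0}. (n - hamming_weight c) choose j) =
        (\<Sum>w\<in>W. \<Sum>c\<in>{c \<in> C - {0}. hamming_weight c = w}. (n - hamming_weight c) choose j)"
      unfolding W_def by (rule sum.image_gen) (use finC in simp)
    also have "\<dots> = (\<Sum>w\<in>W. a w * ((n - w) choose j))"
      by (intro sum.cong refl) (simp add: a_def)
    also have "\<dots> = a w1 * (x1 choose j) + a w2 * (x2 choose j)"
      using w12(2) ne j by (simp add: W x1_def x2_def)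
    finally have "3 ^ j * ((n choose j) + (a w1 * (x1 choose j) + a w2 * (x2 choose j))) =
        (n choose j) * card C"
      using sum_choose_zeros[OF q C d'(1), of j] d'(2) j by (simp add: n_def)
    then have "real (3 ^ j * ((n choose j) + (a w1 * (x1 choose j) + a w2 * (x2 choose j)))) =
        real ((n choose j) * card C)"
      by presburger
    then have "3 ^ j * (real (n choose j) + (real (a w1) * real (x1 choose j) + real (a w2) * real (x2 choose j)))
        = real (n choose j) * T"
      by (simp add: T_def)
    then have "real (a w1) * real (x1 choose j) + real (a w2) * real (x2 choose j)
        = real (n choose j) * (T / 3 ^ j - 1)"
      by (simp add: field_simps)
    then have "fact j * (real (a w1) * real (x1 choose j) + real (a w2) * real (x2 choose j))
        = fact j * (real (n choose j) * (T / 3 ^ j - 1))"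
      by (rule arg_cong)
    then show ?thesis
      by (simp only: real_choose_eq[symmetric] distrib_left mult_ac)
  qed
  define m where "m = n - 1"
  have m: "real n = real m + 1" "m \<ge> 5"
    using n6 by (simp_all add: m_def)
  \<comment> \<open>Passing from \<open>a w\<close> to \<open>a w * (n - w) / n\<close> counts the words that vanish at a fixed coordinate.\<close>
  define b1 b2 where "b1 = real (a w1) * real x1 / real n" and "b2 = real (a w2) * real x2 / real n"
  define z1 z2 where "z1 = real x1 - 1" and "z2 = real x2 - 1"
  define Q where "Q = T / 3"
  have Tpos: "T > 0"
    by (simp add: T)
  have n0: "real n \<noteq> 0"
    using n6 by simp
  \<comment> \<open>A falling factorial of order \<open>j + 1\<close> in \<open>x1\<close> is
    \<open>x1\<close> times one of order \<open>j\<close> in \<open>x1 - 1\<close>; the factor is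
    absorbed into \<open>b1\<close>, and \<open>n\<close> cancels on the other side.\<close>
  have reduce: "b1 * p1 + b2 * p2 = p * s"
    if "real (a w1) * (real x1 * p1) + real (a w2) * (real x2 * p2) = real n * p * s" for p1 p2 p s
    using that n0 by (simp add: b1_def b2_def field_simps)
  have prods: "(\<Prod>i = 0..<1. y - real i) = y * 1" "(\<Prod>i = 0..<2. y - real i) = y * (y - 1)"
    "(\<Prod>i = 0..<3. y - real i) = y * ((y - 1) * ((y - 1) - 1))"
    "(\<Prod>i = 0..<4. y - real i) = y * ((y - 1) * ((y - 1) - 1) * ((y - 1) - 2))"
    "(\<Prod>i = 0..<5. y - real i) = y * ((y - 1) * ((y - 1) - 1) * ((y - 1) - 2) * ((y - 1) - 3))"
    for y :: real
    by (simp_all add: numeral_eq_Suc algebra_simps)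
  have mn: "real n - 1 = real m"
    using m by simp
  have M0: "b1 + b2 = Q - 1"
    using reduce[of 1 1 1 "Q - 1"] moments[of 1] unfolding prods by (simp add: Q_def)
  have M1: "b1 * z1 + b2 * z2 = real m * (Q / 3 - 1)"
    by (rule reduce) (use moments[of 2] in \<open>unfold prods mn z1_def z2_def Q_def, simp\<close>)
  have M2: "b1 * (z1 * (z1 - 1)) + b2 * (z2 * (z2 - 1)) = real m * (real m - 1) * (Q / 9 - 1)"
    by (rule reduce) (use moments[of 3] in \<open>unfold prods mn z1_def z2_def Q_def, simp\<close>)
  have M3: "b1 * (z1 * (z1 - 1) * (z1 - 2)) + b2 * (z2 * (z2 - 1) * (z2 - 2)) =
      real m * (real m - 1) * (real m - 2) * (Q / 27 - 1)"
    by (rule reduce) (use moments[of 4] in \<open>unfold prods mn z1_def z2_def Q_def, simp\<close>)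
  have M4: "b1 * (z1 * (z1 - 1) * (z1 - 2) * (z1 - 3)) + b2 * (z2 * (z2 - 1) * (z2 - 2) * (z2 - 3)) =
      real m * (real m - 1) * (real m - 2) * (real m - 3) * (Q / 81 - 1)"
    by (rule reduce) (use moments[of 5] in \<open>unfold prods mn z1_def z2_def Q_def, simp\<close>)
  have wz: "real m - z1 = real w1" "real m - z2 = real w2"
    using x m by (simp_all add: z1_def z2_def)
  have m1: "real m > 1" and Qpos: "Q > 0"
    using m Tpos by (simp_all add: Q_def)
  note res = two_weight_moments[OF M0 M1 M2 M3 M4 m1 Qpos, unfolded wz]
  have "real (3 ^ vec.dim C) = real (3 * (2 * m\<^sup>2 + 1))"
    using res(1) by (simp add: Q_def T)
  then have dim: "(3::nat) ^ vec.dim C = 3 * (2 * m\<^sup>2 + 1)"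
    by (simp only: of_nat_eq_iff)
  then have "vec.dim C \<noteq> 0"
    by (intro notI) simp
  then obtain r where r: "vec.dim C = Suc r"
    using not0_implies_Suc by blast
  then have r3: "3 ^ r = 2 * m\<^sup>2 + 1"
    using dim by simp
  then have "real (3 ^ r) = Q"
    using res(1) by simp
  then have "real (9 * (w1 * w2)) = real (2 * 3 ^ r)" "real (3 * (w1 + w2)) = real (4 * m + 1)"
    using res(2,3) by simp_all
  then have "9 * (w1 * w2) = 2 * 3 ^ r" "3 * (w1 + w2) = 4 * m + 1"
    by (simp_all only: of_nat_eq_iff)
  note lloyd = ternary_lloyd_equation[OF this(2,1) r3]
  show n12: "CARD('n) = 12"
    using lloyd(2) m by (simp add: n_def)
  show "vec.dim C = 6"
    using lloyd(3) m r by simp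
  show "hamming_weight ` (C - {0}) = {6, 9, 12}"
    using lloyd(1) m W n12 by (auto simp: W_def[symmetric] n_def)
qed

section \<open>Self-orthogonality from divisible weights\<close>

lemma square_eq_if_nonzero:
  fixes x :: "'f::field"
  assumes "CARD('f) = 3"
  shows "x * x = (if x = 0 then 0 else 1)"
  using ternary_cases(1)[OF assms, of x] by auto

text \<open>Nonzero squares are 1, so the product of a word with itself is its weight modulo 3;
  polarization with \<open>u + v\<close> gives the mixed products, as 2 is invertible.\<close>

lemma weights_divisible_by_3_self_orthogonal:
  fixes C :: "('f::field ^ 'n::finite) set"
  assumes q: "CARD('f) = 3" and C: "vec.subspace C"
    and div: "\<And>c. c \<in> C \<Longrightarrow> 3 dvd hamming_weight c" and uv: "u \<in> C" "v \<in> C"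
  shows "(\<Sum>i\<in>UNIV. u $ i * v $ i) = 0"
proof -
  have three: "(3::'f) = 0"
    using ternary_cases(2)[OF q] by (metis add.right_inverse add.commute one_plus_numeral semiring_norm(3) one_add_one numeral_One)
  have norm: "(\<Sum>i\<in>UNIV. c $ i * c $ i) = 0" if "c \<in> C" for c
  proof -
    have "(\<Sum>i\<in>UNIV. c $ i * c $ i) = of_nat (hamming_weight c)"
      by (simp add: square_eq_if_nonzero[OF q] hamming_weight_def sum.If_cases Collect_neg_eq[symmetric])
    then show ?thesis
      using div[OF that] three by (auto elim!: dvdE)
  qed
  have "(\<Sum>i\<in>UNIV. (u + v) $ i * (u + v) $ i) =
      (\<Sum>i\<in>UNIV. u $ i * u $ i) + (\<Sum>i\<in>UNIV. v $ i * v $ i) + 2 * (\<Sum>i\<in>UNIV. u $ i * v $ i)"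
    by (simp add: sum.distrib[symmetric] sum_distrib_left algebra_simps)
  then have "2 * (\<Sum>i\<in>UNIV. u $ i * v $ i) = 0"
    using norm[OF uv(1)] norm[OF uv(2)] norm[OF vec.subspace_add[OF C uv]] by simp
  then show ?thesis
    using ternary_cases(2)[OF q] by simp
qed

section \<open>The case of dual distance 5\<close>

lemma distinct_elements_5:
  assumes "card S = 5"
  obtains a b c d e where "S = {a, b, c, d, e}" "distinct [a, b, c, d, e]"
proof -
  have "finite S"
    using assms by (intro card_ge_0_finite) simp
  then obtain xs where xs: "set xs = S" "distinct xs"
    using finite_distinct_list by blast
  then have "length xs = 5"
    using assms distinct_card by fastforce
  then show thesis
    using xs that by (auto simp: numeral_eq_Suc length_Suc_conv)
qed

lemma distinct_elements_6:
  assumes "card S = 6"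
  obtains a b c d e f where "S = {a, b, c, d, e, f}" "distinct [a, b, c, d, e, f]"
proof -
  have "finite S"
    using assms by (intro card_ge_0_finite) simp
  then obtain xs where xs: "set xs = S" "distinct xs"
    using finite_distinct_list by blast
  then have "length xs = 6"
    using assms distinct_card by fastforce
  then show thesis
    using xs that by (auto simp: numeral_eq_Suc length_Suc_conv)
qed

text \<open>Otherwise nonzero words vanish on at most four coordinates. The relation given by a dual
  word \<open>u\<close> of weight 5 then makes the dimension 4 and lowers the number of zeros to at
  most three, so any four coordinates form an information set. Length 5 yields four weights; larger
  length fails by the pigeonhole principle on two further coordinates.\<close>

lemma three_weight_dual_distance_5:
  fixes C :: "('f::field ^ 'n::finite) set"
  assumes q: "CARD('f) = 3" and C: "vec.subspace C" and three: "three_weight_code C"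
    and d': "has_min_weight (dual_code C) 5"
  shows "\<exists>c\<in>C - {0}. hamming_weight c + 5 \<le> CARD('n)"
proof (rule ccontr)
  assume contra: "\<not> ?thesis"
  note cases = ternary_cases(1)[OF q]
  note two = ternary_cases(2)[OF q]
  have vanish5: "c = 0" if "c \<in> C" "\<forall>j\<in>J. c $ j = 0" "card J = 5" for c J
  proof (rule ccontr)
    assume "c \<noteq> 0"
    have "hamming_weight c \<le> card (- J)"
      unfolding hamming_weight_def using that(2) by (intro card_mono) auto
    also have "\<dots> = CARD('n) - 5"
      using that(3) by (simp add: Compl_eq_Diff_UNIV card_Diff_subset)
    moreover have "5 \<le> CARD('n)"
      using that(3) card_mono[of UNIV J] by simp
    ultimately show False
      using contra that(1) \<open>c \<noteq> 0\<close> by force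
  qed
  obtain u where u: "u \<in> dual_code C" "hamming_weight u = 5"
    using d' by (auto simp: has_min_weight_def)
  then have card_u: "card {i. u $ i \<noteq> 0} = 5"
    by (simp add: hamming_weight_def)
  have orth: "(\<Sum>i\<in>UNIV. u $ i * c $ i) = 0" if "c \<in> C" for c
    using u that by (simp add: dual_code_def)
  have n5: "CARD('n) \<ge> 5"
    using hamming_weight_le[of u] u by simp
  obtain j where j: "u $ j \<noteq> 0"
    using card_u by fastforce
  define I where "I = {i. u $ i \<noteq> 0} - {j}"
  have card_I: "card I = 4"
    using card_u j by (simp add: I_def)
  \<comment> \<open>Four zeros on the support of \<open>u\<close> force the fifth by
    orthogonality.\<close>
  have "c = 0" if c: "c \<in> C" "\<forall>i\<in>I. c $ i = 0" for c
  proof -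
    have "(\<Sum>i\<in>UNIV. u $ i * c $ i) = (\<Sum>i\<in>{j}. u $ i * c $ i)"
      using c(2) by (intro sum.mono_neutral_right) (auto simp: I_def)
    then have "c $ j = 0"
      using orth[OF c(1)] j by simp
    then show ?thesis
      using vanish5[of c "{i. u $ i \<noteq> 0}"] c card_u by (auto simp: I_def)
  qed
  then have "{c \<in> C. \<forall>i\<in>I. c $ i = 0} = {0}"
    using vec.subspace_0[OF C] by auto
  then have card_C: "card C = 3 ^ 4"
    using card_vanishing_words[OF C d', of I] card_I q by simp
  have vanish4: "c = 0" if "c \<in> C" "\<forall>j\<in>J. c $ j = 0" "card J = 4" for c J
  proof -
    have "3 ^ 4 * card {c \<in> C. \<forall>j\<in>J. c $ j = 0} = 3 ^ 4 * 1"
      using card_vanishing_words[OF C d', of J] that(3) q card_C by simp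
    then have "card {c \<in> C. \<forall>j\<in>J. c $ j = 0} = 1"
      by (simp only: mult_cancel1) simp
    then obtain x where x: "{c \<in> C. \<forall>j\<in>J. c $ j = 0} = {x}"
      using card_1_singletonE by blast
    have "c \<in> {x}" "0 \<in> {x}"
      unfolding x[symmetric] using that vec.subspace_0[OF C] by simp_all
    then show ?thesis
      by simp
  qed
  show False
  proof (cases "CARD('n) = 5")
    case True
    then obtain p1 p2 p3 p4 p5
      where p: "(UNIV :: 'n set) = {p1, p2, p3, p4, p5}" "distinct [p1, p2, p3, p4, p5]"
      using distinct_elements_5[of "UNIV :: 'n set"] by metis
    have "{i. u $ i \<noteq> 0} = UNIV"
      using card_u True by (intro card_subset_eq) auto
    then have u_ne: "u $ i \<noteq> 0" for i
      by blast
    have uu: "u $ i * u $ i = 1" for i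
      using u_ne by (simp add: square_eq_if_nonzero[OF q])
    \<comment> \<open>The entries of \<open>u\<close> square to 1, so in the variables
      \<open>y\<close> orthogonality to \<open>u\<close> says only that the five values have sum
      0.\<close>
    have word: "\<exists>c\<in>C. c $ p1 = u $ p1 * y1 \<and> c $ p2 = u $ p2 * y2 \<and> c $ p3 = u $ p3 * y3 \<and>
        c $ p4 = u $ p4 * y4 \<and> u $ p5 * c $ p5 = - (y1 + y2 + y3 + y4)" for y1 y2 y3 y4
    proof -
      have "card {p1, p2, p3, p4} < 5"
        using p(2) by simp
      from code_attains_values[OF C d' this, of "\<lambda>p. u $ p *
          (if p = p1 then y1 else if p = p2 then y2 else if p = p3 then y3 else y4)"]
      obtain c where c: "c \<in> C" and "\<forall>p\<in>{p1, p2, p3, p4}. c $ p = u $ p *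
          (if p = p1 then y1 else if p = p2 then y2 else if p = p3 then y3 else y4)"
        by blast
      then have val: "c $ p1 = u $ p1 * y1" "c $ p2 = u $ p2 * y2" "c $ p3 = u $ p3 * y3"
          "c $ p4 = u $ p4 * y4"
        using p(2) by auto
      have "u $ p1 * c $ p1 + u $ p2 * c $ p2 + u $ p3 * c $ p3 + u $ p4 * c $ p4 + u $ p5 * c $ p5 = 0"
        using orth[OF c] p(2) unfolding p(1) by (simp add: add.assoc)
      then have "u $ p5 * c $ p5 = - (y1 + y2 + y3 + y4)"
        unfolding val mult.assoc[symmetric] uu by (simp add: add_eq_0_iff)
      with c val show ?thesis
        by blast
    qed
    have weight: "hamming_weight c = card {p \<in> {p1, p2, p3, p4, p5}. c $ p \<noteq> 0}" for c :: "'f ^ 'n"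
      unfolding hamming_weight_def by (simp flip: p(1))
    have three_0: "(1 + 1 + 1 :: 'f) = 0"
      using two by simp
    \<comment> \<open>The zero-sum vectors (1, -1, 0, 0, 0), (1, 1, 1, 0, 0), (1, 1, -1, -1, 0) and
      (1, 1, 1, 1, -1) supply the weights 2, 3, 4 and 5.\<close>
    have "2 \<in> hamming_weight ` (C - {0})"
    proof -
      obtain c where c: "c \<in> C" "c $ p1 = u $ p1" "c $ p2 = - u $ p2" "c $ p3 = 0" "c $ p4 = 0"
          "c $ p5 = 0"
        using word[of 1 "- 1" 0 0] u_ne by auto
      have "{p \<in> {p1, p2, p3, p4, p5}. c $ p \<noteq> 0} = {p1, p2}"
        using c u_ne by auto
      then have "hamming_weight c = 2"
        using p(2) by (simp add: weight)
      then show ?thesis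
        using c(1) hamming_weight_eq_0_iff[of c] by force
    qed
    moreover have "3 \<in> hamming_weight ` (C - {0})"
    proof -
      obtain c where c: "c \<in> C" "c $ p1 = u $ p1" "c $ p2 = u $ p2" "c $ p3 = u $ p3" "c $ p4 = 0"
          "c $ p5 = 0"
        using word[of 1 1 1 0] u_ne three_0 by auto
      have "{p \<in> {p1, p2, p3, p4, p5}. c $ p \<noteq> 0} = {p1, p2, p3}"
        using c u_ne by auto
      then have "hamming_weight c = 3"
        using p(2) by (simp add: weight)
      then show ?thesis
        using c(1) hamming_weight_eq_0_iff[of c] by force
    qed
    moreover have "4 \<in> hamming_weight ` (C - {0})"
    proof -
      obtain c where c: "c \<in> C" "c $ p1 = u $ p1" "c $ p2 = u $ p2" "c $ p3 = - u $ p3" "c $ p4 = - u $ p4"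
          "c $ p5 = 0"
        using word[of 1 1 "- 1" "- 1"] u_ne by auto
      have "{p \<in> {p1, p2, p3, p4, p5}. c $ p \<noteq> 0} = {p1, p2, p3, p4}"
        using c u_ne by auto
      then have "hamming_weight c = 4"
        using p(2) by (simp add: weight)
      then show ?thesis
        using c(1) hamming_weight_eq_0_iff[of c] by force
    qed
    moreover have "5 \<in> hamming_weight ` (C - {0})"
    proof -
      have "u $ p5 * x = - (1 + 1 + 1 + 1) \<Longrightarrow> x \<noteq> 0" for x
        unfolding three_0 by auto
      then obtain c where c: "c \<in> C" "c $ p1 = u $ p1" "c $ p2 = u $ p2" "c $ p3 = u $ p3" "c $ p4 = u $ p4"
          "c $ p5 \<noteq> 0"
        using word[of 1 1 1 1] by (metis mult.right_neutral)
      have "{p \<in> {p1, p2, p3, p4, p5}. c $ p \<noteq> 0} = {p1, p2, p3, p4, p5}"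
        using c u_ne by auto
      then have "hamming_weight c = 5"
        using p(2) by (simp add: weight)
      then show ?thesis
        using c(1) hamming_weight_eq_0_iff[of c] by force
    qed
    ultimately have "{2, 3, 4, 5} \<subseteq> hamming_weight ` (C - {0})"
      by simp
    from card_mono[OF _ this] show False
      using three ternary_finite_words[OF q, of C] by (simp add: three_weight_code_def)
  next
    case False
    then have "6 \<le> CARD('n)"
      using n5 by simp
    then obtain S :: "'n set" where "card S = 6"
      using obtain_subset_with_card_n by blast
    then obtain p1 p2 p3 p4 p5 p6 where p: "distinct [p1, p2, p3, p4, p5, p6 :: 'n]"
      using distinct_elements_6 by metis
    \<comment> \<open>A zero at \<open>p5\<close> or \<open>p6\<close> would be the fourth zero of a
      nonzero word.\<close>
    have row: "\<exists>c\<in>C. c $ p = 1 \<and> c $ p' = 0 \<and> c $ p'' = 0 \<and> c $ p4 = 0 \<and> c $ p5 \<noteq> 0 \<and> c $ p6 \<noteq> 0"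
      if dist: "distinct [p, p', p'', p4, p5, p6]" for p p' p''
    proof -
      have "card {p, p', p'', p4} < 5"
        using dist by simp
      from code_attains_values[OF C d' this, of "\<lambda>x. if x = p then 1 else 0"]
      obtain c where c: "c \<in> C" "\<forall>x\<in>{p, p', p'', p4}. c $ x = (if x = p then 1 else 0)"
        by blast
      then have val: "c $ p = 1" "c $ p' = 0" "c $ p'' = 0" "c $ p4 = 0"
        using dist by auto
      have "c $ x \<noteq> 0" if "x \<in> {p5, p6}" for x
        using vanish4[OF c(1), of "{p', p'', p4, x}"] val that dist by auto
      then show ?thesis
        using c(1) val by auto
    qed
    \<comment> \<open>Two of the three rows below agree up to a scalar on the last two coordinates.\<close>
    have clash: False
      if "distinct [p, p', p'', p4, p5, p6]" "c \<in> C" "c' \<in> C" "c $ p = 1" "c $ p'' = 0" "c $ p4 = 0"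
        "c $ p5 \<noteq> 0" "c' $ p = 0" "c' $ p'' = 0" "c' $ p4 = 0" "c' $ p5 \<noteq> 0"
        "c $ p5 * c $ p6 = c' $ p5 * c' $ p6"
      for c c' :: "'f ^ 'n" and p p' p''
    proof -
      define v where "v = (c' $ p5) *s c - (c $ p5) *s c'"
      \<comment> \<open>Since nonzero squares are 1, the product of the two entries is also their
        ratio.\<close>
      have "c $ p6 = c $ p5 * (c $ p5 * c $ p6)" "c' $ p6 = c' $ p5 * (c' $ p5 * c' $ p6)"
        using that(7,11) by (simp_all add: mult.assoc[symmetric] square_eq_if_nonzero[OF q])
      then have "c' $ p5 * c $ p6 = c $ p5 * c' $ p6"
        using that(12) by (metis mult.left_commute)
      then have "\<forall>x\<in>{p'', p4, p5, p6}. v $ x = 0"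
        using that by (simp add: v_def)
      moreover have "v \<in> C"
        unfolding v_def using that by (intro vec.subspace_diff[OF C] vec.subspace_scale[OF C])
      ultimately have "v = 0"
        using vanish4[of v "{p'', p4, p5, p6}"] that(1) by simp
      moreover have "v $ p \<noteq> 0"
        using that by (simp add: v_def)
      ultimately show False
        by simp
    qed
    obtain c1 where c1: "c1 \<in> C" "c1 $ p1 = 1" "c1 $ p2 = 0" "c1 $ p3 = 0" "c1 $ p4 = 0"
        "c1 $ p5 \<noteq> 0" "c1 $ p6 \<noteq> 0"
      using row[of p1 p2 p3] p by auto
    obtain c2 where c2: "c2 \<in> C" "c2 $ p2 = 1" "c2 $ p1 = 0" "c2 $ p3 = 0" "c2 $ p4 = 0"
        "c2 $ p5 \<noteq> 0" "c2 $ p6 \<noteq> 0"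
      using row[of p2 p1 p3] p by auto
    obtain c3 where c3: "c3 \<in> C" "c3 $ p3 = 1" "c3 $ p1 = 0" "c3 $ p2 = 0" "c3 $ p4 = 0"
        "c3 $ p5 \<noteq> 0" "c3 $ p6 \<noteq> 0"
      using row[of p3 p1 p2] p by auto
    have "c $ p5 * c $ p6 = 1 \<or> c $ p5 * c $ p6 = - 1" if "c $ p5 \<noteq> 0" "c $ p6 \<noteq> 0"
      for c :: "'f ^ 'n"
      using cases[of "c $ p5 * c $ p6"] that by simp
    from this[OF c1(6,7)] this[OF c2(6,7)] this[OF c3(6,7)]
    have "c1 $ p5 * c1 $ p6 = c2 $ p5 * c2 $ p6 \<or> c1 $ p5 * c1 $ p6 = c3 $ p5 * c3 $ p6 \<or>
        c2 $ p5 * c2 $ p6 = c3 $ p5 * c3 $ p6"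
      by auto
    then show False
      using clash[of p1 p2 p3 c1 c2] clash[of p1 p3 p2 c1 c3] clash[of p2 p3 p1 c2 c3] p c1 c2 c3
      by auto
  qed
qed

section \<open>Conference matrices of order six\<close>

text \<open>The bordered matrix of the pentagon \<open>1 2 3 4 5\<close>, with 1 for adjacent and - 1 for
  non-adjacent vertices.\<close>

definition paley :: "nat \<Rightarrow> nat \<Rightarrow> 'f::field" where
  "paley i j =
     (if i = j then 0
      else if i = 0 \<or> j = 0 \<or> Suc i = j \<or> Suc j = i \<or> (i = 1 \<and> j = 5) \<or> (i = 5 \<and> j = 1) then 1
      else - 1)"

lemma ternary_numerals:
  assumes "CARD('f::field) = 3"
  shows "(2::'f) = - 1" and "(3::'f) = 0" and "(4::'f) = 1" and "(1::'f) \<noteq> - 1" and "(- 1::'f) \<noteq> 1"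
proof -
  show two: "(2::'f) = - 1" and one: "(1::'f) \<noteq> - 1"
    by (fact ternary_cases[OF assms])+
  show "(- 1::'f) \<noteq> 1"
    using one by metis
  have "(3::'f) = 2 + 1"
    by simp
  then show three: "(3::'f) = 0"
    unfolding two by simp
  have "(4::'f) = 3 + 1"
    by simp
  then show "(4::'f) = 1"
    unfolding three by simp
qed

text \<open>The variables are the entries between the vertices 1 to 5 once the border is scaled to
  1; row 1 and \<open>b23 = 1\<close> are already inserted in the equations. Row 2 is fixed by its
  sum and its product with row 1, then every further row by its sum and its products with rows 1 and
  2.\<close>

lemma pentagon_core:
  fixes b21 b23 b24 b25 b31 b32 b34 b35 b41 b42 b43 b45 b51 b52 b53 b54 :: "'f::field"
  assumes q: "CARD('f) = 3"
    and nz: "b21 \<noteq> 0" "b24 \<noteq> 0" "b25 \<noteq> 0" "b31 \<noteq> 0" "b32 \<noteq> 0" "b34 \<noteq> 0" "b35 \<noteq> 0"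
      "b41 \<noteq> 0" "b42 \<noteq> 0" "b43 \<noteq> 0" "b45 \<noteq> 0" "b51 \<noteq> 0" "b52 \<noteq> 0" "b53 \<noteq> 0" "b54 \<noteq> 0"
    and row2: "b21 + 1 + b24 + b25 = 0" and row3: "b31 + b32 + b34 + b35 = 0"
    and row4: "b41 + b42 + b43 + b45 = 0" and row5: "b51 + b52 + b53 + b54 = 0"
    and pair12: "1 + - 1 * 1 + - 1 * b24 + 1 * b25 = 0" and pair13: "1 + 1 * b32 + - 1 * b34 + 1 * b35 = 0"
    and pair14: "1 + 1 * b42 + - 1 * b43 + 1 * b45 = 0" and pair15: "1 + 1 * b52 + - 1 * b53 + - 1 * b54 = 0"
    and pair23: "1 + b21 * b31 + b24 * b34 + b25 * b35 = 0"
    and pair24: "1 + b21 * b41 + 1 * b43 + b25 * b45 = 0"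
    and pair25: "1 + b21 * b51 + 1 * b53 + b24 * b54 = 0"
  shows "b21 = 1 \<and> b24 = - 1 \<and> b25 = - 1 \<and> b31 = - 1 \<and> b32 = 1 \<and> b34 = 1 \<and> b35 = - 1 \<and>
    b41 = - 1 \<and> b42 = - 1 \<and> b43 = 1 \<and> b45 = 1 \<and> b51 = 1 \<and> b52 = - 1 \<and> b53 = - 1 \<and> b54 = 1"
proof -
  note num = ternary_numerals[OF q]
  have pm: "x = 1 \<or> x = - 1" if "x \<noteq> 0" for x :: 'f
    using ternary_cases(1)[OF q, of x] that by simp
  have row2': "b21 = 1 \<and> b24 = - 1 \<and> b25 = - 1"
    using pm[OF nz(1)] pm[OF nz(2)] pm[OF nz(3)] row2 pair12 by (auto simp: num)
  have row5': "b51 = 1 \<and> b52 = - 1 \<and> b53 = - 1 \<and> b54 = 1"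
    using pm[OF nz(12)] pm[OF nz(13)] pm[OF nz(14)] pm[OF nz(15)] row5 pair15 pair25 row2'
    by (auto simp: num)
  have row3': "b31 = - 1 \<and> b32 = 1 \<and> b34 = 1 \<and> b35 = - 1"
    using pm[OF nz(4)] pm[OF nz(5)] pm[OF nz(6)] pm[OF nz(7)] row3 pair13 pair23 row2'
    by (auto simp: num)
  have row4': "b41 = - 1 \<and> b42 = - 1 \<and> b43 = 1 \<and> b45 = 1"
    using pm[OF nz(8)] pm[OF nz(9)] pm[OF nz(10)] pm[OF nz(11)] row4 pair14 pair24 row2'
    by (auto simp: num)
  show ?thesis
    using row2' row3' row4' row5' by blast
qed

lemma less_6_cases: "(i::nat) < 6 \<Longrightarrow> i = 0 \<or> i = 1 \<or> i = 2 \<or> i = 3 \<or> i = 4 \<or> i = 5"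
  by linarith

text \<open>Scaling by the border row and column \<open>s0\<close> leaves a core \<open>b\<close> of
  signs. Four signs with sum 0 modulo 3 are two 1 and two - 1, so orthogonality modulo 3 is as
  strong as over the integers. Naming the vertices along the pentagon then leads to
  \<open>pentagon_core\<close>.\<close>

lemma conference_matrix_6:
  fixes a :: "'i \<Rightarrow> 'i \<Rightarrow> 'f::field"
  assumes q: "CARD('f) = 3" and S: "card S = 6"
    and nz: "\<And>i j. i \<in> S \<Longrightarrow> j \<in> S \<Longrightarrow> i \<noteq> j \<Longrightarrow> a i j \<noteq> 0"
    and orth: "\<And>i j. i \<in> S \<Longrightarrow> j \<in> S \<Longrightarrow> i \<noteq> j \<Longrightarrow> (\<Sum>k\<in>S - {i, j}. a i k * a j k) = 0"
  shows "\<exists>xs \<rho> \<mu>. length xs = 6 \<and> distinct xs \<and> set xs = S \<and> (\<forall>i<6. \<rho> i \<noteq> 0 \<and> \<mu> i \<noteq> 0) \<and>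
    (\<forall>i<6. \<forall>j<6. i \<noteq> j \<longrightarrow> a (xs ! i) (xs ! j) = \<rho> i * \<mu> j * paley i j)"
proof -
  note num = ternary_numerals[OF q]
  note sq = square_eq_if_nonzero[OF q]
  obtain s0 s1 e2 e3 e4 e5 where S': "S = {s0, s1, e2, e3, e4, e5}" "distinct [s0, s1, e2, e3, e4, e5]"
    using distinct_elements_6[OF S] by metis
  \<comment> \<open>Multiplying by the border entries divides by them, as nonzero squares are
    1.\<close>
  define b where "b i j = a i s0 * a i j * a s0 j" for i j
  define good where "good i j k l m \<longleftrightarrow> distinct [s0, i, j, k, l, m] \<and> S = {s0, i, j, k, l, m}"
    for i j k l m
  have sq1: "a i j * a i j = 1" if "i \<in> S" "j \<in> S" "i \<noteq> j" for i j
    using nz[OF that] by (simp add: sq)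
  have row: "b i j + b i k + b i l + b i m = 0" if g: "good i j k l m" for i j k l m
  proof -
    have "S - {s0, i} = {j, k, l, m}"
      using g by (auto simp: good_def)
    then have "a s0 j * a i j + a s0 k * a i k + a s0 l * a i l + a s0 m * a i m = 0"
      using orth[of s0 i] g by (simp add: good_def add.assoc)
    then have "a i s0 * (a s0 j * a i j + a s0 k * a i k + a s0 l * a i l + a s0 m * a i m) = 0"
      by simp
    then show ?thesis
      by (simp add: b_def distrib_left mult_ac)
  qed
  have pair: "1 + b i k * b j k + b i l * b j l + b i m * b j m = 0" if g: "good i j k l m" for i j k l m
  proof -
    have "S - {i, j} = {s0, k, l, m}"
      using g by (auto simp: good_def)
    then have sum0: "a i s0 * a j s0 + a i k * a j k + a i l * a j l + a i m * a j m = 0"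
      using orth[of i j] g by (simp add: good_def add.assoc)
    have bb: "b i x * b j x = a i s0 * a j s0 * (a i x * a j x)" if "x \<in> {k, l, m}" for x
    proof -
      have "b i x * b j x = a i s0 * a j s0 * (a i x * a j x) * (a s0 x * a s0 x)"
        by (simp add: b_def mult_ac)
      also have "a s0 x * a s0 x = 1"
        using that g by (intro sq1) (auto simp: good_def)
      finally show ?thesis
        by simp
    qed
    have "a i s0 * a j s0 * (a i s0 * a j s0) = (a i s0 * a i s0) * (a j s0 * a j s0)"
      by (simp add: mult_ac)
    also have "\<dots> = 1"
      using sq1[of i s0] sq1[of j s0] g by (auto simp: good_def)
    finally have one: "a i s0 * a j s0 * (a i s0 * a j s0) = 1" .
    have "1 + b i k * b j k + b i l * b j l + b i m * b j m =
        a i s0 * a j s0 * (a i s0 * a j s0 + a i k * a j k + a i l * a j l + a i m * a j m)"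
      by (simp only: bb distrib_left one insert_iff simp_thms)
    then show ?thesis
      using sum0 by simp
  qed
  have pm: "x = 1 \<or> x = - 1" if "x \<noteq> 0" for x :: 'f
    using ternary_cases(1)[OF q, of x] that by simp
  have good1: "good s1 e2 e3 e4 e5"
    using S' by (simp add: good_def)
  have swaps: "good i j k l m \<Longrightarrow> good i j l k m" "good i j k l m \<Longrightarrow> good j i k l m" for i j k l m
    by (auto simp: good_def)
  have "\<exists>s2 s3 s4 s5. good s1 s2 s3 s4 s5 \<and> b s1 s2 = 1 \<and> b s1 s5 = 1 \<and> b s1 s3 = - 1 \<and> b s1 s4 = - 1"
  proof -
    have "b s1 e2 \<noteq> 0" "b s1 e3 \<noteq> 0" "b s1 e4 \<noteq> 0" "b s1 e5 \<noteq> 0"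
      using nz S' by (auto simp: b_def)
    then have v: "b s1 e2 = 1 \<or> b s1 e2 = - 1" "b s1 e3 = 1 \<or> b s1 e3 = - 1"
        "b s1 e4 = 1 \<or> b s1 e4 = - 1" "b s1 e5 = 1 \<or> b s1 e5 = - 1"
      using pm by blast+
    \<comment> \<open>The six choices of two neighbours of \<open>s1\<close>; each has its labelling
      below, with the neighbours as \<open>s2\<close> and \<open>s5\<close>.\<close>
    have "b s1 e2 = 1 \<and> b s1 e3 = 1 \<and> b s1 e4 = - 1 \<and> b s1 e5 = - 1 \<or>
        b s1 e2 = 1 \<and> b s1 e4 = 1 \<and> b s1 e3 = - 1 \<and> b s1 e5 = - 1 \<or>
        b s1 e2 = 1 \<and> b s1 e5 = 1 \<and> b s1 e3 = - 1 \<and> b s1 e4 = - 1 \<or>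
        b s1 e3 = 1 \<and> b s1 e4 = 1 \<and> b s1 e2 = - 1 \<and> b s1 e5 = - 1 \<or>
        b s1 e3 = 1 \<and> b s1 e5 = 1 \<and> b s1 e2 = - 1 \<and> b s1 e4 = - 1 \<or>
        b s1 e4 = 1 \<and> b s1 e5 = 1 \<and> b s1 e2 = - 1 \<and> b s1 e3 = - 1"
      using v row[OF good1] by (elim disjE) (simp_all add: num)
    moreover have "good s1 e2 e4 e5 e3" "good s1 e2 e3 e5 e4" "good s1 e2 e3 e4 e5" "good s1 e3 e2 e5 e4" "good s1 e3 e2 e4 e5" "good s1 e4 e2 e3 e5"
      using good1 by (auto simp: good_def)
    ultimately show ?thesis
      by blast
  qed
  then obtain s2 f3 f4 s5 where f: "good s1 s2 f3 f4 s5" "b s1 s2 = 1" "b s1 s5 = 1"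
      "b s1 f3 = - 1" "b s1 f4 = - 1"
    by blast
  \<comment> \<open>If both were - 1, the product with row \<open>s1\<close> would force
    \<open>b s2 s5 = 0\<close>. The neighbour found here gets the name \<open>s3\<close>.\<close>
  have "b s2 f3 = 1 \<or> b s2 f4 = 1"
  proof -
    have g: "good s2 s1 f3 f4 s5"
      using f(1) by (rule swaps(2))
    have "b s2 s1 \<noteq> 0" "b s2 f3 \<noteq> 0" "b s2 f4 \<noteq> 0" "b s2 s5 \<noteq> 0"
      using nz f(1) by (auto simp: b_def good_def)
    then show ?thesis
      using pm[of "b s2 s1"] pm[of "b s2 f3"] pm[of "b s2 f4"] pm[of "b s2 s5"] row[OF g] pair[OF f(1)] f(2-)
      by (auto simp: num)
  qed
  then obtain s3 s4 where g: "good s1 s2 s3 s4 s5" and row1: "b s1 s2 = 1" "b s1 s5 = 1"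
      "b s1 s3 = - 1" "b s1 s4 = - 1" and b23: "b s2 s3 = 1"
    using f swaps(1) by blast
  have g': "good s2 s1 s3 s4 s5" "good s3 s1 s2 s4 s5" "good s4 s1 s2 s3 s5" "good s5 s1 s2 s3 s4"
      "good s1 s3 s2 s4 s5" "good s1 s4 s2 s3 s5" "good s1 s5 s2 s3 s4"
      "good s2 s3 s1 s4 s5" "good s2 s4 s1 s3 s5" "good s2 s5 s1 s3 s4"
    using g by (auto simp: good_def)
  have dist: "distinct [s0, s1, s2, s3, s4, s5]" and SS: "S = {s0, s1, s2, s3, s4, s5}"
    using g by (simp_all add: good_def)
  have b_nz: "b i j \<noteq> 0" if "i \<in> S" "j \<in> S" "i \<noteq> j" "i \<noteq> s0" "j \<noteq> s0" for i j
    using nz[of i s0] nz[of i j] nz[of s0 j] that S'(1) by (simp add: b_def)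
  have core: "b s2 s1 = 1 \<and> b s2 s4 = - 1 \<and> b s2 s5 = - 1 \<and> b s3 s1 = - 1 \<and> b s3 s2 = 1 \<and> b s3 s4 = 1 \<and>
      b s3 s5 = - 1 \<and> b s4 s1 = - 1 \<and> b s4 s2 = - 1 \<and> b s4 s3 = 1 \<and> b s4 s5 = 1 \<and> b s5 s1 = 1 \<and>
      b s5 s2 = - 1 \<and> b s5 s3 = - 1 \<and> b s5 s4 = 1"
  proof (rule pentagon_core[OF q])
    show "b s2 s1 + 1 + b s2 s4 + b s2 s5 = 0" "b s3 s1 + b s3 s2 + b s3 s4 + b s3 s5 = 0"
      "b s4 s1 + b s4 s2 + b s4 s3 + b s4 s5 = 0" "b s5 s1 + b s5 s2 + b s5 s3 + b s5 s4 = 0"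
      using row[OF g'(1)] row[OF g'(2)] row[OF g'(3)] row[OF g'(4)] by (simp_all only: b23)
    show "1 + - 1 * 1 + - 1 * b s2 s4 + 1 * b s2 s5 = 0" "1 + 1 * b s3 s2 + - 1 * b s3 s4 + 1 * b s3 s5 = 0"
      "1 + 1 * b s4 s2 + - 1 * b s4 s3 + 1 * b s4 s5 = 0" "1 + 1 * b s5 s2 + - 1 * b s5 s3 + - 1 * b s5 s4 = 0"
      using pair[OF g] pair[OF g'(5)] pair[OF g'(6)] pair[OF g'(7)] by (simp_all only: b23 row1)
    show "1 + b s2 s1 * b s3 s1 + b s2 s4 * b s3 s4 + b s2 s5 * b s3 s5 = 0"
      "1 + b s2 s1 * b s4 s1 + 1 * b s4 s3 + b s2 s5 * b s4 s5 = 0"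
      "1 + b s2 s1 * b s5 s1 + 1 * b s5 s3 + b s2 s4 * b s5 s4 = 0"
      using pair[OF g'(8)] pair[OF g'(9)] pair[OF g'(10)] by (simp_all only: b23)
  qed (rule b_nz; use dist in \<open>auto simp: SS\<close>)+
  define xs where "xs = [s0, s1, s2, s3, s4, s5]"
  \<comment> \<open>The border entries are their own inverses and so also undo the scaling. The
    value 1 at index 0 matches the border of ones in \<open>paley\<close>.\<close>
  define \<rho> where "\<rho> i = (if i = 0 then 1 else a (xs ! i) s0)" for i
  define \<mu> where "\<mu> j = (if j = 0 then 1 else a s0 (xs ! j))" for j
  have xs: "length xs = 6" "distinct xs" "set xs = S"
    using g by (simp_all add: xs_def good_def)
  have xs_nth: "xs ! i \<in> S" "i \<noteq> 0 \<Longrightarrow> xs ! i \<noteq> s0" if "i < 6" for i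
    using that xs nth_mem[of i xs] nth_eq_iff_index_eq[of xs i 0] by (auto simp: xs_def)
  have s0: "s0 \<in> S" "xs ! 0 = s0"
    by (simp_all add: S' xs_def)
  have scal: "\<rho> i \<noteq> 0 \<and> \<mu> i \<noteq> 0" if "i < 6" for i
    using nz xs_nth[OF that] s0 by (auto simp: \<rho>_def \<mu>_def)
  have b_paley: "b (xs ! i) (xs ! j) = paley i j" if ij: "i < 6" "j < 6" "i \<noteq> j" "i \<noteq> 0" "j \<noteq> 0" for i j
    using less_6_cases[OF ij(1)] less_6_cases[OF ij(2)] ij(3-) core row1 b23
    by (elim disjE) (simp_all add: paley_def xs_def)
  have "a (xs ! i) (xs ! j) = \<rho> i * \<mu> j * paley i j" if ij: "i < 6" "j < 6" "i \<noteq> j" for i j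
  proof -
    consider "i = 0" | "j = 0" | "i \<noteq> 0" "j \<noteq> 0"
      by blast
    then show ?thesis
    proof cases
      case 3
      have "\<rho> i * \<mu> j * paley i j = a (xs ! i) s0 * a s0 (xs ! j) * b (xs ! i) (xs ! j)"
        using b_paley ij 3 by (simp add: \<rho>_def \<mu>_def)
      also have "\<dots> = (a (xs ! i) s0 * a (xs ! i) s0) * (a s0 (xs ! j) * a s0 (xs ! j)) * a (xs ! i) (xs ! j)"
        by (simp add: b_def mult_ac)
      also have "\<dots> = a (xs ! i) (xs ! j)"
        using sq1[of "xs ! i" s0] sq1[of s0 "xs ! j"] xs_nth[OF ij(1)] xs_nth[OF ij(2)] s0 3 by simp
      finally show ?thesis
        by simp
    qed (use ij s0 in \<open>simp_all add: \<rho>_def \<mu>_def paley_def\<close>)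
  qed
  with xs scal show ?thesis
    by blast
qed

section \<open>The systematic form of the extended Golay code\<close>

text \<open>The row space of \<open>[I | paley]\<close> with coordinate \<open>p k\<close> divided by \<open>l k\<close>.\<close>

definition paley_code :: "(nat \<Rightarrow> 'n) \<Rightarrow> (nat \<Rightarrow> 'f) \<Rightarrow> ('f::field ^ 'n::finite) set" where
  "paley_code p l =
     {c. \<forall>j<6. l (6 + j) * c $ p (6 + j) = (\<Sum>i<6. l i * c $ p i * paley i j)}"

lemma subspace_paley_code: "vec.subspace (paley_code p l)"
  unfolding vec.subspace_def
proof (intro conjI ballI allI)
  fix r c assume c: "c \<in> paley_code p l"
  have "(\<Sum>i<6. l i * (r * c $ p i) * paley i j) = r * (\<Sum>i<6. l i * c $ p i * paley i j)" for j
    unfolding sum_distrib_left by (intro sum.cong) (simp_all add: mult_ac)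
  then show "r *s c \<in> paley_code p l"
    using c by (simp add: paley_code_def mult.left_commute[of _ r])
qed (simp_all add: paley_code_def distrib_left distrib_right sum.distrib)

text \<open>Matching coordinate \<open>p k\<close> with \<open>p' k\<close> and scaling by
  \<open>l k / l' k\<close> carries one system of check equations to the other. Hence it suffices to
  bring both codes into this form.\<close>

lemma paley_codes_equivalent:
  fixes p :: "nat \<Rightarrow> 'n::finite" and p' :: "nat \<Rightarrow> 'm::finite" and l l' :: "nat \<Rightarrow> 'f::field"
  assumes p: "bij_betw p {..<12} UNIV" and l: "\<And>k. k < 12 \<Longrightarrow> l k \<noteq> 0"
    and p': "bij_betw p' {..<12} UNIV" and l': "\<And>k. k < 12 \<Longrightarrow> l' k \<noteq> 0"
  shows "monomially_equivalent (paley_code p l) (paley_code p' l')"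
proof -
  define r where "r = inv_into {..<12} p"
  define r' where "r' = inv_into {..<12} p'"
  have r: "r (p k) = k" "r' (p' k) = k" if "k < 12" for k
    using that by (simp_all add: r_def r'_def bij_betw_inv_into_left[OF p] bij_betw_inv_into_left[OF p'])
  have rr: "bij_betw r UNIV {..<12}" "bij_betw r' UNIV {..<12}"
    using p p' by (simp_all add: r_def r'_def bij_betw_inv_into)
  then have less: "r x < 12" "r' y < 12" for x y
    by (auto dest!: bij_betwE)
  have pr: "p (r x) = x" "p' (r' y) = y" for x y
    by (simp_all add: r_def r'_def bij_betw_inv_into_right[OF p] bij_betw_inv_into_right[OF p'])
  define \<sigma> where "\<sigma> = p \<circ> r'"
  define a where "a y = l (r' y) / l' (r' y)" for y
  define M where "M = (\<lambda>c. \<chi> j. a j * c $ \<sigma> j :: 'f ^ 'm)"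
  have M: "l' k * M c $ p' k = l k * c $ p k" if "k < 12" for c k
    using that l'[OF that] by (simp add: M_def a_def \<sigma>_def r)
  have iff: "M c \<in> paley_code p' l' \<longleftrightarrow> c \<in> paley_code p l" for c
    by (simp add: paley_code_def M)
  have "paley_code p' l' \<subseteq> M ` paley_code p l"
  proof
    fix v assume v: "v \<in> paley_code p' l'"
    define c where "c = (\<chi> x. l' (r x) / l (r x) * v $ p' (r x))"
    have "M c = v"
      unfolding vec_eq_iff
    proof
      fix y
      show "M c $ y = v $ y"
        using l[OF less(2)[of y]] l'[OF less(2)[of y]] less(2)[of y]
        by (simp add: M_def a_def \<sigma>_def c_def r pr)
    qed
    then show "v \<in> M ` paley_code p l"
      using v iff by (metis imageI)
  qed
  then have "paley_code p' l' = M ` paley_code p l"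
    using iff by blast
  moreover have "bij \<sigma>"
    unfolding \<sigma>_def using rr(2) p by (rule bij_betw_trans)
  moreover have "\<forall>j. a j \<noteq> 0"
    using l l' less by (simp add: a_def)
  ultimately show ?thesis
    unfolding monomially_equivalent_def M_def by blast
qed

section \<open>Explicit coordinates for the Golay code\<close>

lemma UNIV_11: "(UNIV :: 11 set) = {0, 1, 2, 3, 4, 5, 6, 7, 8, 9, 10}"
  by (rule card_subset_eq[symmetric]) simp_all

definition golay_shift :: "11 \<Rightarrow> 'f::field ^ 11" where
  "golay_shift s = (\<chi> i. golay_generator $ (i - s))"

lemma golay_shift_nth [simp]: "golay_shift s $ i = golay_generator $ (i - s)"
  by (simp add: golay_shift_def)

text \<open>Negative indices are included because differences modulo 11 reduce to them.\<close>

lemma golay_generator_nth: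
  "golay_generator $ 0 = - 1" "golay_generator $ 1 = 0" "golay_generator $ 2 = 1"
  "golay_generator $ 3 = - 1" "golay_generator $ 4 = 1" "golay_generator $ 5 = 1"
  "golay_generator $ 6 = 0" "golay_generator $ 7 = 0" "golay_generator $ 8 = 0"
  "golay_generator $ 9 = 0" "golay_generator $ 10 = 0"
  "golay_generator $ (- 1) = 0" "golay_generator $ (- 2) = 0" "golay_generator $ (- 3) = 0"
  "golay_generator $ (- 4) = 0" "golay_generator $ (- 5) = 0" "golay_generator $ (- 6) = 1"
  "golay_generator $ (- 7) = 1" "golay_generator $ (- 8) = - 1" "golay_generator $ (- 9) = 1"
  "golay_generator $ (- 10) = 0"
  by (simp_all add: golay_generator_def)

lemma extend_word_nth [simp]:
  "extend_word c $ None = - (\<Sum>j\<in>UNIV. c $ j)" "extend_word c $ Some j = c $ j"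
  by (simp_all add: extend_word_def)

lemma extend_word_add: "extend_word (c + c') = extend_word c + extend_word c'"
  by (auto simp: vec_eq_iff extend_word_def sum.distrib split: option.split)

lemma extend_word_scale: "extend_word (r *s c) = r *s extend_word c"
  by (auto simp: vec_eq_iff extend_word_def sum_distrib_left split: option.split)

lemma extend_word_zero: "extend_word 0 = 0"
  by (auto simp: vec_eq_iff extend_word_def split: option.split)

lemma extend_word_sum: "extend_word (\<Sum>i\<in>A. f i) = (\<Sum>i\<in>A. extend_word (f i))"
proof (induction A rule: infinite_finite_induct)
  case (insert x F)
  then show ?case
    by (simp add: extend_word_add)
qed (simp_all add: extend_word_zero)

lemma sum_golay_shift:
  assumes "CARD('f::field) = 3"
  shows "(\<Sum>j\<in>UNIV. golay_shift s $ j :: 'f) = 1"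
proof -
  have "(\<Sum>j\<in>UNIV. golay_shift s $ j :: 'f) = (\<Sum>j\<in>UNIV. golay_generator $ j)"
    by (rule sum.reindex_bij_witness[of _ "\<lambda>j. j + s" "\<lambda>j. j - s"]) simp_all
  also have "\<dots> = 1"
    unfolding UNIV_11 by (simp add: golay_generator_nth)
  finally show ?thesis .
qed

text \<open>The information coordinates come first. This order and the signs of
  \<open>golay_scalar\<close> turn the check part of the systematic generator matrix into
  \<open>paley\<close>.\<close>

definition golay_coordinate :: "nat \<Rightarrow> 11 option" where
  "golay_coordinate k =
     [Some 0, Some 1, Some 3, Some 2, Some 4, Some 5, Some 7, None, Some 8, Some 9, Some 10, Some 6] ! k"

definition golay_scalar :: "nat \<Rightarrow> 'f::field" where
  "golay_scalar k = [1, - 1, 1, 1, 1, - 1, 1, - 1, 1, - 1, 1, - 1] ! k"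

lemma bij_golay_coordinate: "bij_betw golay_coordinate {..<12} UNIV"
proof -
  let ?xs = "[Some 0, Some 1, Some 3, Some 2, Some 4, Some 5, Some 7, None, Some 8, Some 9, Some 10, Some 6]
    :: 11 option list"
  have "set ?xs = UNIV"
    unfolding UNIV_option_conv UNIV_11 by auto
  then have "bij_betw ((!) ?xs) {..<12} UNIV"
    by (intro bij_betw_nth) simp_all
  then show ?thesis
    by (simp only: golay_coordinate_def[abs_def])
qed

lemma all_less_6: "(\<forall>j<6. P j) \<longleftrightarrow> P 0 \<and> P 1 \<and> P 2 \<and> P 3 \<and> P 4 \<and> P (5::nat)"
  using less_6_cases by auto

lemma sum_less_6: "(\<Sum>i<6. f i) = f 0 + f 1 + f 2 + f 3 + f 4 + f (5::nat)"
  by (simp add: numeral_eq_Suc)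

lemma extended_golay_shift_in_paley_code:
  assumes q: "CARD('f::field) = 3"
  shows "extend_word (golay_shift s :: 'f ^ 11) \<in> paley_code golay_coordinate golay_scalar"
proof -
  note num = ternary_numerals[OF q]
  have "s \<in> {0, 1, 2, 3, 4, 5, 6, 7, 8, 9, 10}"
    unfolding UNIV_11[symmetric] by simp
  then show ?thesis
    unfolding paley_code_def all_less_6 sum_less_6
    using sum_golay_shift[OF q]
    by (auto simp: golay_coordinate_def golay_scalar_def paley_def golay_generator_nth num)
qed

text \<open>Row \<open>i\<close> expresses the word of the code that is the \<open>i\<close>-th unit vector on the information
  coordinates in terms of the first six shifts of the generator.\<close>

definition golay_row :: "nat \<Rightarrow> 'f::field ^ 11" where
  "golay_row i = (\<Sum>s<6. [[- 1, 0, - 1, 1, 1, 1],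
       [0, - 1, 0, - 1, 1, 1],
       [0, 0, 0, - 1, 0, - 1],
       [0, 0, - 1, 0, - 1, 1],
       [0, 0, 0, 0, - 1, 0],
       [0, 0, 0, 0, 0, - 1]] ! i ! s *s golay_shift (of_nat s))"

lemma extended_golay_row:
  assumes q: "CARD('f::field) = 3" and "i < 6" and "k < 12"
  shows "extend_word (golay_row i :: 'f ^ 11) $ golay_coordinate k =
    (if k < 6 then if k = i then 1 else 0 else golay_scalar k * golay_scalar i * paley i (k - 6))"
proof -
  note num = ternary_numerals[OF q]
  have "k = 0 \<or> k = 1 \<or> k = 2 \<or> k = 3 \<or> k = 4 \<or> k = 5 \<or>
      k = 6 \<or> k = 7 \<or> k = 8 \<or> k = 9 \<or> k = 10 \<or> k = 11"
    using \<open>k < 12\<close> by presburger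
  then show ?thesis
    using less_6_cases[OF \<open>i < 6\<close>]
    unfolding golay_row_def extend_word_sum[of _ "{..<6}"] extend_word_scale
    unfolding sum_less_6
    by (elim disjE; hypsubst)
      (simp_all add: sum_golay_shift[OF q, simplified] sum_golay_shift[OF q, of 0, simplified]
        golay_coordinate_def golay_scalar_def paley_def golay_generator_nth num)
qed

lemma golay_scalar_square:
  assumes "k < 12"
  shows "golay_scalar k * golay_scalar k = (1 :: 'f::field)"
proof -
  have "golay_scalar k \<in> set [1, - 1, 1, 1, 1, - 1, 1, - 1, 1, - 1, 1, - 1 :: 'f]"
    unfolding golay_scalar_def using assms by (intro nth_mem) simp
  then show ?thesis
    by auto
qed

text \<open>The shifts satisfy the check equations. Conversely, a solution is the combination of the
  extended rows with its own six information coordinates as coefficients; the check coordinates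
  agree because every \<open>golay_scalar\<close> squares to 1.\<close>

lemma extended_ternary_golay_code_eq_paley_code:
  assumes q: "CARD('f::field) = 3"
  shows "(extended_ternary_golay_code :: ('f ^ 11 option) set) = paley_code golay_coordinate golay_scalar"
    (is "?G = ?H")
proof
  have span: "ternary_golay_code = vec.span (range (golay_shift :: 11 \<Rightarrow> 'f ^ 11))"
    by (simp add: ternary_golay_code_def golay_shift_def[abs_def])
  have "vec.subspace {c :: 'f ^ 11. extend_word c \<in> ?H}"
    using subspace_paley_code[of golay_coordinate "golay_scalar :: nat \<Rightarrow> 'f"]
    unfolding vec.subspace_def
    by (auto simp: extend_word_add extend_word_scale extend_word_zero)
  moreover have "range golay_shift \<subseteq> {c :: 'f ^ 11. extend_word c \<in> ?H}"
    using extended_golay_shift_in_paley_code[OF q] by auto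
  ultimately have "ternary_golay_code \<subseteq> {c :: 'f ^ 11. extend_word c \<in> ?H}"
    unfolding span by (intro vec.span_minimal)
  then show "?G \<subseteq> ?H"
    by (auto simp: extended_ternary_golay_code_def)
  show "?H \<subseteq> ?G"
  proof
    fix v assume v: "v \<in> ?H"
    define c where "c = (\<Sum>i<6. v $ golay_coordinate i *s golay_row i)"
    have "(golay_row i :: 'f ^ 11) \<in> ternary_golay_code" for i
      unfolding span golay_row_def by (intro vec.span_sum vec.span_scale vec.span_base) auto
    then have "c \<in> ternary_golay_code"
      unfolding c_def span by (intro vec.span_sum vec.span_scale) auto
    have nth: "extend_word c $ x = (\<Sum>i<6. v $ golay_coordinate i * extend_word (golay_row i) $ x)" for x
      by (simp add: c_def extend_word_sum extend_word_scale)
    have "extend_word c $ golay_coordinate k = v $ golay_coordinate k" if k: "k < 12" for k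
    proof (cases "k < 6")
      case True
      have "extend_word c $ golay_coordinate k =
          (\<Sum>i<6. if k = i then v $ golay_coordinate i else 0)"
        unfolding nth by (intro sum.cong refl) (use True in \<open>simp add: extended_golay_row[OF q]\<close>)
      also have "\<dots> = v $ golay_coordinate k"
        using True by simp
      finally show ?thesis .
    next
      case False
      define j where "j = k - 6"
      have j: "j < 6" "k = 6 + j"
        using False k by (auto simp: j_def)
      have "extend_word c $ golay_coordinate k =
          (\<Sum>i<6. golay_scalar k * (golay_scalar i * v $ golay_coordinate i * paley i j))"
        unfolding nth
        by (intro sum.cong refl)
          (use False k in \<open>simp add: extended_golay_row[OF q] j_def mult_ac\<close>)
      also have "\<dots> = golay_scalar k * (golay_scalar k * v $ golay_coordinate k)"
        using v j by (simp add: paley_code_def sum_distrib_left)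
      also have "\<dots> = v $ golay_coordinate k"
        by (simp add: mult.assoc[symmetric] golay_scalar_square[OF k])
      finally show ?thesis .
    qed
    moreover have "\<exists>k<12. x = golay_coordinate k" for x
      using bij_golay_coordinate by (auto simp: bij_betw_def)
    ultimately have "extend_word c = v"
      unfolding vec_eq_iff by metis
    with \<open>c \<in> ternary_golay_code\<close> show "v \<in> ?G"
      by (auto simp: extended_ternary_golay_code_def)
  qed
qed

section \<open>Uniqueness of the code\<close>

text \<open>On the five coordinates of \<open>J\<close> all entries are signs, so the difference or
  the sum of the words vanishes on at least three of them. Its support then has at most 8 - 3
  elements, less than the minimum weight.\<close>

lemma overlapping_words_proportional:
  fixes C :: "('f::field ^ 'n::finite) set"
  assumes q: "CARD('f) = 3" and C: "vec.subspace C"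
    and min: "\<And>c. c \<in> C \<Longrightarrow> c \<noteq> 0 \<Longrightarrow> 6 \<le> hamming_weight c"
    and c: "c \<in> C" "c' \<in> C" and J: "card J = 5" "\<And>j. j \<in> J \<Longrightarrow> c $ j \<noteq> 0 \<and> c' $ j \<noteq> 0"
    and K: "J \<subseteq> K" "card K \<le> 8" "\<And>i. i \<notin> K \<Longrightarrow> c $ i = 0 \<and> c' $ i = 0"
  shows "c = c' \<or> c = - c'"
proof -
  have *: "v = 0" if v: "v \<in> C" "\<And>i. i \<notin> K \<Longrightarrow> v $ i = 0" and large: "3 \<le> card {j\<in>J. v $ j = 0}" for v
  proof (rule ccontr)
    assume "v \<noteq> 0"
    then have "6 \<le> hamming_weight v"
      using min v by simp
    also have "hamming_weight v \<le> card (K - {j\<in>J. v $ j = 0})"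
      unfolding hamming_weight_def using v(2) by (intro card_mono) auto
    also have "\<dots> = card K - card {j\<in>J. v $ j = 0}"
      using K(1) by (intro card_Diff_subset) auto
    finally show False
      using large K(2) by simp
  qed
  have "J = {j\<in>J. (c - c') $ j = 0} \<union> {j\<in>J. (c + c') $ j = 0}"
  proof -
    have "(c - c') $ j = 0 \<or> (c + c') $ j = 0" if "j \<in> J" for j
      using J(2)[OF that] ternary_cases(1)[OF q, of "c $ j"] ternary_cases(1)[OF q, of "c' $ j"] by auto
    then show ?thesis
      by blast
  qed
  then have "5 \<le> card {j\<in>J. (c - c') $ j = 0} + card {j\<in>J. (c + c') $ j = 0}"
    using J(1) by (metis card_Un_le)
  then consider "3 \<le> card {j\<in>J. (c - c') $ j = 0}" | "3 \<le> card {j\<in>J. (c + c') $ j = 0}"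
    by linarith
  then show ?thesis
  proof cases
    case 1
    then have "c - c' = 0"
      using K(3) by (intro *) (simp_all add: vec.subspace_diff[OF C c])
    then show ?thesis
      by simp
  next
    case 2
    then have "c + c' = 0"
      using K(3) by (intro *) (simp_all add: vec.subspace_add[OF C c])
    then show ?thesis
      by (simp add: add_eq_0_iff2)
  qed
qed

text \<open>Restriction to \<open>S\<close> is injective on \<open>C\<close>, hence surjective by
  counting.\<close>

lemma information_set_attains_values:
  fixes C :: "('f::field ^ 'n::finite) set"
  assumes q: "CARD('f) = 3" and C: "vec.subspace C" and card: "card C = 3 ^ card S"
    and inj: "\<And>c. c \<in> C \<Longrightarrow> \<forall>i\<in>S. c $ i = 0 \<Longrightarrow> c = 0"
  shows "\<exists>c\<in>C. \<forall>i\<in>S. c $ i = x i"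
proof -
  define f where "f c = restrict (($) c) S" for c :: "'f ^ 'n"
  have "inj_on f C"
  proof (rule inj_onI)
    fix c c' assume cc: "c \<in> C" "c' \<in> C" and "f c = f c'"
    then have "c $ i = c' $ i" if "i \<in> S" for i
      using that by (metis f_def restrict_apply')
    then have "c - c' = 0"
      by (intro inj) (simp_all add: vec.subspace_diff[OF C cc])
    then show "c = c'"
      by simp
  qed
  then have "card (f ` C) = card (PiE S (\<lambda>_. UNIV :: 'f set))"
    using card by (simp add: card_image card_PiE q)
  moreover have "finite (PiE S (\<lambda>_. UNIV :: 'f set))"
    using q by (intro finite_PiE) (auto intro: card_ge_0_finite)
  ultimately have "f ` C = PiE S (\<lambda>_. UNIV :: 'f set)"
    by (intro card_subset_eq) (auto simp: f_def)
  moreover have "restrict x S \<in> PiE S (\<lambda>_. UNIV :: 'f set)"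
    by simp
  ultimately obtain c where "c \<in> C" "restrict x S = f c"
    by blast
  then show ?thesis
    by (metis f_def restrict_apply')
qed

text \<open>Each row of the check part has a single zero, distinct rows have it in distinct columns,
  and \<open>\<phi>\<close> pairs rows with these columns so that the zeros form the diagonal
  required by \<open>conference_matrix_6\<close>.\<close>

lemma golay_parameters_imp_paley_code:
  fixes C :: "('f::field ^ 'n::finite) set"
  assumes q: "CARD('f) = 3" and C: "vec.subspace C" and n: "CARD('n) = 12" and dim: "vec.dim C = 6"
    and weights: "hamming_weight ` (C - {0}) = {6, 9, 12}"
  shows "\<exists>p l. bij_betw p {..<12} UNIV \<and> (\<forall>k<12. l k \<noteq> 0) \<and> C = paley_code p l"
proof -
  have wt: "hamming_weight c \<in> {6, 9, 12}" if "c \<in> C" "c \<noteq> 0" for c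
    using weights that by blast
  have min: "6 \<le> hamming_weight c" if "c \<in> C" "c \<noteq> 0" for c
    using wt[OF that] by auto
  have div: "3 dvd hamming_weight c" if "c \<in> C" for c
    using wt[OF that] hamming_weight_eq_0_iff[of c] by (cases "c = 0") auto
  note orth = weights_divisible_by_3_self_orthogonal[OF q C div]
  note proportional = overlapping_words_proportional[OF q C min]
  obtain c0 where c0: "c0 \<in> C" "hamming_weight c0 = 6"
    using weights by (metis (no_types, lifting) DiffD1 image_iff insertI1)
  define T0 where "T0 = {i. c0 $ i \<noteq> 0}"
  have T0: "card T0 = 6"
    using c0 by (simp add: T0_def hamming_weight_def)
  obtain x where x: "x \<in> T0"
    using T0 by fastforce
  have "T0 \<noteq> UNIV"
    using T0 n by auto
  then obtain y where y: "y \<notin> T0"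
    by blast
  \<comment> \<open>The support of \<open>c0\<close> with one coordinate exchanged is not the support of a word,
    so its complement is an information set.\<close>
  define T where "T = insert y (T0 - {x})"
  define S where "S = - T"
  have T: "card T = 6"
    using T0 x y by (simp add: T_def)
  have S: "card S = 6"
    using T n by (simp add: S_def Compl_eq_Diff_UNIV card_Diff_subset)
  have info: "c = 0" if c: "c \<in> C" "\<forall>i\<in>S. c $ i = 0" for c
  proof (rule ccontr)
    assume "c \<noteq> 0"
    have sub: "{i. c $ i \<noteq> 0} \<subseteq> T"
      using c(2) by (auto simp: S_def)
    moreover have "card T \<le> card {i. c $ i \<noteq> 0}"
      using min[OF c(1) \<open>c \<noteq> 0\<close>] T by (simp add: hamming_weight_def)
    ultimately have supp: "{i. c $ i \<noteq> 0} = T"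
      by (intro card_seteq) auto
    have "c = c0 \<or> c = - c0"
    proof (rule proportional[of c c0 "T0 - {x}" "insert y T0"])
      show "c $ j \<noteq> 0 \<and> c0 $ j \<noteq> 0" if "j \<in> T0 - {x}" for j
        using that supp by (auto simp: T_def T0_def)
      show "c $ i = 0 \<and> c0 $ i = 0" if "i \<notin> insert y T0" for i
        using that supp by (auto simp: T_def T0_def)
    qed (use c c0 T0 x y in auto)
    then have "c $ x \<noteq> 0"
      using x by (auto simp: T0_def)
    then show False
      using supp x y by (auto simp: T_def)
  qed
  have card_C: "card C = 3 ^ card S"
    using card_subspace[OF C] q dim S by simp
  have "\<exists>c\<in>C. \<forall>j\<in>S. c $ j = (if j = i then 1 else 0)" for i
    by (rule information_set_attains_values[OF q C card_C info])
  then obtain r where r: "\<And>i. r i \<in> C" "\<And>i j. j \<in> S \<Longrightarrow> r i $ j = (if j = i then 1 else 0)"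
    by metis
  \<comment> \<open>The row has weight at most 1 + 6, and 6 is the only weight below 9.\<close>
  have "\<exists>p\<in>T. r i $ p = 0 \<and> (\<forall>p'\<in>T. p' \<noteq> p \<longrightarrow> r i $ p' \<noteq> 0)" if i: "i \<in> S" for i
  proof -
    have supp: "{p. r i $ p \<noteq> 0} = insert i {p\<in>T. r i $ p \<noteq> 0}"
    proof -
      have "r i $ p = 0" if "p \<notin> T" "p \<noteq> i" for p
        using r(2)[of p i] that by (simp add: S_def)
      moreover have "r i $ i \<noteq> 0"
        using r(2)[OF i, of i] by simp
      ultimately show ?thesis
        by blast
    qed
    have "hamming_weight (r i) = Suc (card {p\<in>T. r i $ p \<noteq> 0})"
      unfolding hamming_weight_def supp using i by (intro card_insert_disjoint) (auto simp: S_def)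
    moreover have "card {p\<in>T. r i $ p \<noteq> 0} \<le> 6"
      unfolding T[symmetric] by (intro card_mono) auto
    moreover have "r i \<noteq> 0"
      using r(2)[OF i, of i] by auto
    ultimately have "card {p\<in>T. r i $ p \<noteq> 0} = 5"
      using wt[OF r(1), of i] by auto
    moreover have "card (T - {p\<in>T. r i $ p \<noteq> 0}) = card T - card {p\<in>T. r i $ p \<noteq> 0}"
      by (intro card_Diff_subset) auto
    ultimately have "card (T - {p\<in>T. r i $ p \<noteq> 0}) = 1"
      using T by simp
    then obtain p where "T - {p\<in>T. r i $ p \<noteq> 0} = {p}"
      by (rule card_1_singletonE)
    then show ?thesis
      by blast
  qed
  then obtain \<phi> where \<phi>: "\<And>i. i \<in> S \<Longrightarrow> \<phi> i \<in> T \<and> r i $ \<phi> i = 0 \<and>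
      (\<forall>p'\<in>T. p' \<noteq> \<phi> i \<longrightarrow> r i $ p' \<noteq> 0)"
    by metis
  \<comment> \<open>Rows with the same zero column share five nonzero coordinates inside a set of
    eight, so they would be proportional; but \<open>r j\<close> vanishes at
    \<open>i\<close>.\<close>
  have inj: "inj_on \<phi> S"
  proof (rule inj_onI, rule ccontr)
    fix i j assume ij: "i \<in> S" "j \<in> S" "\<phi> i = \<phi> j" "i \<noteq> j"
    have "r i = r j \<or> r i = - r j"
    proof (rule proportional[of "r i" "r j" "T - {\<phi> i}" "insert i (insert j T)"])
      show "card (T - {\<phi> i}) = 5"
        using \<phi>[OF ij(1)] T by simp
      show "r i $ p \<noteq> 0 \<and> r j $ p \<noteq> 0" if "p \<in> T - {\<phi> i}" for p
        using that \<phi> ij by auto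
      show "card (insert i (insert j T)) \<le> 8"
        using T ij by (simp add: S_def card_insert_if)
      show "r i $ p = 0 \<and> r j $ p = 0" if "p \<notin> insert i (insert j T)" for p
        using that r(2)[of p] by (auto simp: S_def)
    qed (use r in auto)
    then have "r j $ i \<noteq> 0"
      using r(2)[OF ij(1), of i] by auto
    then show False
      using r(2)[OF ij(1), of j] ij by simp
  qed
  have "\<phi> ` S = T"
    using \<phi> inj S T by (intro card_subset_eq) (auto simp: card_image)
  define a where "a i j = r i $ \<phi> j" for i j
  have a_nz: "a i j \<noteq> 0" if "i \<in> S" "j \<in> S" "i \<noteq> j" for i j
  proof -
    have "\<phi> j \<noteq> \<phi> i"
      using inj that by (auto dest: inj_onD)
    then show ?thesis
      using \<phi> that by (simp add: a_def)
  qed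
  have a_diag: "a i i = 0" if "i \<in> S" for i
    using \<phi>[OF that] by (simp add: a_def)
  have a_orth: "(\<Sum>k\<in>S - {i, j}. a i k * a j k) = 0" if ij: "i \<in> S" "j \<in> S" "i \<noteq> j" for i j
  proof -
    have "r i $ p * r j $ p = 0" if "p \<in> UNIV - T" for p
      using r(2)[of p i] r(2)[of p j] that ij(3) by (auto simp: S_def)
    then have "(\<Sum>p\<in>UNIV. r i $ p * r j $ p) = (\<Sum>p\<in>T. r i $ p * r j $ p)"
      by (intro sum.mono_neutral_right) auto
    also have "\<dots> = (\<Sum>k\<in>S. a i k * a j k)"
      unfolding \<open>\<phi> ` S = T\<close>[symmetric] a_def by (simp add: sum.reindex[OF inj])
    also have "\<dots> = (\<Sum>k\<in>S - {i, j}. a i k * a j k)"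
      using a_diag by (intro sum.mono_neutral_right) auto
    finally show ?thesis
      using orth[OF _ r(1) r(1), of i j] by simp
  qed
  have "\<exists>xs \<rho> \<mu>. length xs = 6 \<and> distinct xs \<and> set xs = S \<and> (\<forall>i<6. \<rho> i \<noteq> 0 \<and> \<mu> i \<noteq> 0) \<and>
      (\<forall>i<6. \<forall>j<6. i \<noteq> j \<longrightarrow> a (xs ! i) (xs ! j) = \<rho> i * \<mu> j * paley i j)"
    by (rule conference_matrix_6[OF q S]) (rule a_nz a_orth; assumption)+
  then obtain xs \<rho> \<mu> where xs: "length xs = 6" "distinct xs" "set xs = S"
    and scal: "\<forall>i<6. \<rho> i \<noteq> 0 \<and> \<mu> i \<noteq> 0"
    and a_paley: "\<forall>i<6. \<forall>j<6. i \<noteq> j \<longrightarrow> a (xs ! i) (xs ! j) = \<rho> i * \<mu> j * paley i j"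
    by blast
  have a_paley': "a (xs ! i) (xs ! j) = \<rho> i * \<mu> j * paley i j" if "i < 6" "j < 6" for i j
  proof (cases "i = j")
    case True
    then show ?thesis
      using a_diag[of "xs ! i"] xs that nth_mem[of i xs] by (simp add: paley_def)
  qed (use a_paley that in simp)
  \<comment> \<open>The word \<open>c'\<close> below is the codeword with the information part of
    \<open>c\<close>, so \<open>c\<close> lies in \<open>C\<close> exactly when their check parts
    agree.\<close>
  have mem: "c \<in> C \<longleftrightarrow> (\<forall>j\<in>S. c $ \<phi> j = (\<Sum>i\<in>S. c $ i * a i j))" for c
  proof -
    define c' where "c' = (\<Sum>i\<in>S. c $ i *s r i)"
    have c': "c' \<in> C"
      unfolding c'_def by (intro vec.subspace_sum[OF C] vec.subspace_scale[OF C] r(1))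
    have c'_S: "c' $ j = c $ j" if "j \<in> S" for j
    proof -
      have "c' $ j = (\<Sum>i\<in>S. if j = i then c $ i else 0)"
        unfolding c'_def sum_component by (intro sum.cong) (simp_all add: r(2)[OF that])
      then show ?thesis
        using that by simp
    qed
    have c'_T: "c' $ \<phi> j = (\<Sum>i\<in>S. c $ i * a i j)" for j
      by (simp add: c'_def a_def)
    show ?thesis
    proof
      assume "c \<in> C"
      then have "c' - c = 0"
        using c'_S by (intro info) (simp_all add: vec.subspace_diff[OF C c'])
      then show "\<forall>j\<in>S. c $ \<phi> j = (\<Sum>i\<in>S. c $ i * a i j)"
        using c'_T by auto
    next
      assume eq: "\<forall>j\<in>S. c $ \<phi> j = (\<Sum>i\<in>S. c $ i * a i j)"
      have "c' $ p = c $ p" for p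
      proof (cases "p \<in> S")
        case False
        then obtain j where "j \<in> S" "p = \<phi> j"
          using \<open>\<phi> ` S = T\<close> by (auto simp: S_def)
        then show ?thesis
          using eq c'_T by simp
      qed (simp add: c'_S)
      then have "c' = c"
        by (simp add: vec_eq_iff)
      then show "c \<in> C"
        using c' by simp
    qed
  qed
  define ys where "ys = xs @ map \<phi> xs"
  define p where "p = (!) ys"
  \<comment> \<open>The factor \<open>\<mu>\<close> multiplies a whole check equation and moves to
    its other side as an inverse.\<close>
  define l where "l k = (if k < 6 then \<rho> k else inverse (\<mu> (k - 6)))" for k
  have p: "p i = xs ! i" "p (6 + i) = \<phi> (xs ! i)" if "i < 6" for i
    using that xs by (simp_all add: p_def ys_def nth_append)
  have "set ys = UNIV"
    using xs \<open>\<phi> ` S = T\<close> by (auto simp: ys_def S_def)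
  moreover have "length ys = 12"
    using xs by (simp add: ys_def)
  moreover have "distinct ys"
    using \<open>set ys = UNIV\<close> \<open>length ys = 12\<close> n by (intro card_distinct) simp
  ultimately have "bij_betw p {..<12} UNIV"
    unfolding p_def by (intro bij_betw_nth) auto
  moreover have "\<forall>k<12. l k \<noteq> 0"
    using scal by (auto simp: l_def)
  moreover have "C = paley_code p l"
  proof -
    have "bij_betw ((!) xs) {..<6} S"
      using xs by (intro bij_betw_nth) auto
    then have sum_S: "(\<Sum>i\<in>S. f i) = (\<Sum>i<6. f (xs ! i))" for f :: "'n \<Rightarrow> 'f"
      by (rule sum.reindex_bij_betw[symmetric])
    have all_S: "(\<forall>j\<in>S. P j) \<longleftrightarrow> (\<forall>j<6. P (xs ! j))" for P
      using xs by (metis all_nth_imp_all_set nth_mem)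
    have "c \<in> C \<longleftrightarrow> c \<in> paley_code p l" for c
    proof -
      have "(c $ \<phi> (xs ! j) = (\<Sum>i<6. c $ (xs ! i) * a (xs ! i) (xs ! j))) \<longleftrightarrow>
          (l (6 + j) * c $ p (6 + j) = (\<Sum>i<6. l i * c $ p i * paley i j))" if j: "j < 6" for j
      proof -
        have sum_eq: "(\<Sum>i<6. c $ (xs ! i) * a (xs ! i) (xs ! j)) = \<mu> j * (\<Sum>i<6. l i * c $ p i * paley i j)"
          unfolding sum_distrib_left
          by (intro sum.cong) (use j in \<open>simp_all add: a_paley' l_def p mult_ac\<close>)
        have inv: "y = \<mu> j * z \<longleftrightarrow> inverse (\<mu> j) * y = z" for y z
          using scal j by (auto simp: field_simps)
        have l6: "l (6 + j) = inverse (\<mu> j)"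
          by (simp add: l_def)
        show ?thesis
          unfolding sum_eq inv l6 p(2)[OF j] by (rule refl)
      qed
      then show ?thesis
        unfolding mem all_S sum_S paley_code_def by simp
    qed
    then show ?thesis
      by blast
  qed
  ultimately show ?thesis
    by blast
qed

section \<open>Case distinction on the dual distance\<close>

theorem theorem1p3:
  fixes C :: "('f::field ^ 'n::finite) set" and n k d d' t :: nat
  assumes "CARD('f) = 3"
    and "linear_code C n k d"
    and "three_weight_code C"
    and "\<exists>c\<in>C. hamming_weight c = n"
    and "has_min_weight (dual_code C) d'"
    and "AM_condition C n d' t"
  shows "(d' = 6 \<and> n = 12 \<and> k = 6 \<and> d = 6 \<and>
            monomially_equivalent C (extended_ternary_golay_code :: ('f ^ 11 option) set) \<and> t = 5)
         \<or> (d' \<le> 5 \<and> t \<le> 4)"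
proof -
  note q = assms(1)
  have n: "n = CARD('n)" and C: "vec.subspace C" and dim: "vec.dim C = k" and d: "has_min_weight C d"
    using assms(2) by (auto simp: linear_code_def)
  define U where "U = {u. words_of_weight C u \<noteq> {} \<and> 0 < u \<and> int u \<le> int n - int t}"
  have AM: "int d' - int t = int (card U)"
    using assms(6) by (simp add: AM_condition_def U_def)
  have U: "U = {u \<in> hamming_weight ` (C - {0}). int u \<le> int n - int t}"
  proof -
    have "words_of_weight C u \<noteq> {} \<and> 0 < u \<longleftrightarrow> u \<in> hamming_weight ` (C - {0})" for u
      by (auto simp: words_of_weight_def image_iff Bex_def hamming_weight_eq_0_iff[symmetric])
    then show ?thesis
      by (auto simp: U_def)
  qed
  show ?thesis
  proof (cases "d' \<le> 5")
    case True
    \<comment> \<open>The AM-condition gives \<open>t \<le> d'\<close>, so only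
      \<open>d' = t = 5\<close> stands against the bound on \<open>t\<close>.\<close>
    have "\<not> (d' = 5 \<and> t = 5)"
    proof
      assume dt: "d' = 5 \<and> t = 5"
      obtain c where c: "c \<in> C - {0}" "hamming_weight c + 5 \<le> CARD('n)"
        using three_weight_dual_distance_5[OF q C assms(3)] assms(5) dt by blast
      have "finite U"
        using ternary_finite_words[OF q, of C] by (simp add: U)
      moreover have "hamming_weight c \<in> U"
        using c dt by (auto simp: U n)
      ultimately have "card U \<noteq> 0"
        by auto
      then show False
        using AM dt by simp
    qed
    then have "t \<le> 4"
      using AM True by linarith
    with True show ?thesis
      by simp
  next
    case False
    then have "6 \<le> d'"
      by simp
    note golay = three_weight_dual_distance_6[OF q C assms(3) assms(4)[unfolded n] assms(5) this]
    \<comment> \<open>A codeword of weight 6 is then also a dual word, which bounds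
      \<open>d'\<close> by 6.\<close>
    have "C \<subseteq> dual_code C"
    proof
      fix v assume v: "v \<in> C"
      have "3 dvd hamming_weight c" if "c \<in> C" for c
      proof (cases "c = 0")
        case False
        then have "hamming_weight c \<in> {6, 9, 12}"
          using golay(3) that by blast
        then show ?thesis
          by auto
      qed (simp add: hamming_weight_def)
      then show "v \<in> dual_code C"
        using weights_divisible_by_3_self_orthogonal[OF q C _ v] by (simp add: dual_code_def)
    qed
    have "6 \<in> hamming_weight ` (C - {0})"
      unfolding golay(3) by simp
    then obtain v where v: "v \<in> C - {0}" "hamming_weight v = 6"
      by (metis imageE)
    then have "v \<in> dual_code C - {0}"
      using \<open>C \<subseteq> dual_code C\<close> by blast
    then have "d' \<le> hamming_weight v" "d \<le> hamming_weight v"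
      using assms(5) d v(1) unfolding has_min_weight_def by blast+
    then have "d' \<le> 6" "d \<le> 6"
      by (simp_all add: v)
    then have d'6: "d' = 6"
      using \<open>6 \<le> d'\<close> by simp
    have "d \<in> hamming_weight ` (C - {0})"
      using d unfolding has_min_weight_def by blast
    then have d6: "d = 6"
      unfolding golay(3) using \<open>d \<le> 6\<close> by auto
    have n12: "n = 12"
      using golay(1) n by simp
    have U': "U = {u \<in> {6, 9, 12}. int u \<le> 12 - int t}"
      using U golay(3) n12 by simp
    \<comment> \<open>The condition reads \<open>card U = 6 - t\<close>. The weights up to
      \<open>12 - t\<close> number 2, 1, 1, 1 for \<open>t\<close> = 3, 4, 5, 6, so only 5
      fits.\<close>
    have "t = 5"
    proof -
      have "t \<le> 6"
        using AM d'6 by simp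
      moreover have "card U \<le> card {6, 9, 12::nat}"
        unfolding U' by (intro card_mono) auto
      then have "3 \<le> t"
        using AM d'6 by simp
      moreover have "U = {6, 9}" if "t = 3"
        unfolding U' that by auto
      moreover have "U = {6}" if "t = 4"
        unfolding U' that by auto
      moreover have "U = {6}" if "t = 6"
        unfolding U' that by auto
      ultimately consider "t = 5" | "t = 3" "U = {6, 9}" | "t = 4" "U = {6}" | "t = 6" "U = {6}"
        by linarith
      then show ?thesis
        by cases (use AM d'6 in auto)
    qed
    moreover have "monomially_equivalent C (extended_ternary_golay_code :: ('f ^ 11 option) set)"
    proof -
      obtain p l where "bij_betw p {..<12} UNIV" "\<forall>k<12. l k \<noteq> 0" "C = paley_code p l"
        using golay_parameters_imp_paley_code[OF q C golay] by blast
      moreover have "golay_scalar k \<noteq> (0::'f)" if "k < 12" for k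
        using golay_scalar_square[OF that, where 'f = 'f] by auto
      ultimately show ?thesis
        unfolding extended_ternary_golay_code_eq_paley_code[OF q]
        by (auto intro!: paley_codes_equivalent bij_golay_coordinate)
    qed
    moreover have "k = 6"
      using golay(2) dim by simp
    ultimately show ?thesis
      using d'6 d6 n12 by blast
  qed
qed

end
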